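(* Let $n\ge 2$ be an integer and $a>0$. Let $X_1,\dots,X_n$ be independent random variables with common Arcsin distribution on $(-a,a)$, let $\mathbf{R}=(R_1,\dots,R_n)$ be a random vector with the Dirichlet distribution $D_n(1,\dots,1)$ that is independent of $(X_1,\dots,X_n)$, and let $S_n=\sum_{i=1}^n R_iX_i$. Then $S_n$ has the power semicircle distribution on $(-a,a)$ with $\lambda=\frac{n-1}{2}$.
   Context: The Arcsin distribution on $(-a,a)$ is the distribution with density $\frac{1}{\pi\sqrt{a^2-x^2}}$ for $|x|<a$ (and $0$ otherwise). The Dirichlet distribution $D_n(1,\dots,1)$ is the uniform distribution on the simplex $\{(r_1,\dots,r_n): r_i\ge 0,\ \sum_{i=1}^n r_i=1\}$. Equivalently, it is the distribution of the vector of spacings $R_i=U_{(i)}-U_{(i-1)}$, $i=1,\dots,n$, where $U_{(1)}\le\dots\le U_{(n-1)}$ are the order statistics of $n-1$ independent uniform random variables on $[0,1]$, with $U_{(0)}=0$ and $U_{(n)}=1$. The power semicircle distribution on $(-a,a)$ with parameter $\lambda$ has density $$f(x;\lambda,a)=\frac{1}{\sqrt{\pi}\,a^{2\lambda}}\,\frac{\Gamma(\lambda+1)}{\Gamma(\lambda+\frac12)}\,(a^2-x^2)^{\lambda-\frac12},\qquad |x|<a$$ (and $0$ otherwise). *)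

theory Defs
  imports "HOL-Probability.Probability"
begin

definition arcsin_density :: "real \<Rightarrow> real \<Rightarrow> real" where
  "arcsin_density a x = (if \<bar>x\<bar> < a then 1 / (pi * sqrt (a\<^sup>2 - x\<^sup>2)) else 0)"

definition power_semicircle_density :: "real \<Rightarrow> real \<Rightarrow> real \<Rightarrow> real" where
  "power_semicircle_density l a x =
     (if \<bar>x\<bar> < a
      then 1 / (sqrt pi * a powr (2 * l)) * (Gamma (l + 1) / Gamma (l + 1 / 2))
             * (a\<^sup>2 - x\<^sup>2) powr (l - 1 / 2)
      else 0)"

text \<open>Vectors \<open>(r\<^sub>1, \<dots>, r\<^sub>n)\<close> are elements of the product space over \<open>{1..n}\<close>,
  i.e. functions that are \<open>undefined\<close> outside \<open>{1..n}\<close>.\<close>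

definition unit_simplex :: "nat \<Rightarrow> (nat \<Rightarrow> real) set" where
  "unit_simplex n = {r \<in> {1..n} \<rightarrow>\<^sub>E UNIV. (\<forall>i\<in>{1..n}. 0 \<le> r i) \<and> (\<Sum>i=1..n. r i) = 1}"

definition simplex_chart :: "nat \<Rightarrow> (nat \<Rightarrow> real) \<Rightarrow> (nat \<Rightarrow> real)" where
  "simplex_chart n x = (\<lambda>i\<in>{1..n}. if i = n then 1 - (\<Sum>j=1..<n. x j) else x i)"

text \<open>The simplex is a null set of \<open>n\<close>-dimensional Lebesgue measure, so its uniform distribution
  \<open>D\<^sub>n(1,\<dots>,1)\<close> is the normalised \<open>(n-1)\<close>-dimensional Lebesgue measure, transported along the
  affine parametrisation of the hyperplane \<open>r\<^sub>1 + \<dots> + r\<^sub>n = 1\<close> by its first \<open>n - 1\<close> coordinates.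
  An affine parametrisation changes \<open>(n-1)\<close>-dimensional volume only by a constant factor,
  which the normalisation removes.\<close>

definition dirichlet_ones :: "nat \<Rightarrow> (nat \<Rightarrow> real) measure" where
  "dirichlet_ones n =
     distr (uniform_measure (Pi\<^sub>M {1..<n} (\<lambda>_. lborel))
              {x \<in> {1..<n} \<rightarrow>\<^sub>E UNIV. simplex_chart n x \<in> unit_simplex n})
           (Pi\<^sub>M {1..n} (\<lambda>_. borel)) (simplex_chart n)"

end

theory Submission
  imports Defs
begin

text \<open>
  The proof compares moments. The weighted sum \<open>S\<close> and the power semicircle distribution are both
  supported in \<open>[-a,a]\<close>, and a distribution on a bounded interval is determined by its moments
  (lemma \<open>bounded_moments_determine_distribution\<close>).

  The moments of \<open>S\<close> have a simple form because Dirichlet's integral gives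
  \<open>E (\<Prod>i. R\<^sub>i ^ k\<^sub>i) = (n-1)! (\<Prod>i. k\<^sub>i!) / (m+n-1)!\<close> with \<open>m = (\<Sum>i. k\<^sub>i)\<close>,
  and the factorials \<open>k\<^sub>i!\<close> cancel those of the multinomial expansion of \<open>S\<^sup>m\<close>. What is left is
  the sum of \<open>\<Prod>i. E (X\<^sub>i ^ k\<^sub>i)\<close> over all exponents with sum \<open>m\<close>. So
  \<open>(m+n-1 choose m) \<cdot> E (S ^ m)\<close> is the coefficient of \<open>t\<^sup>m\<close> in
  \<open>(\<Sum>k. \<mu>\<^sub>k t\<^sup>k)\<^sup>n\<close>, where \<open>\<mu>\<^sub>k = E (X\<^sub>1 ^ k)\<close>.
  This is lemma \<open>dirichlet_average\<close>; its core is the integral over a scaled simplex in lemma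
  \<open>nn_integral_corner_simplex_linear_moment\<close>.

  For arcsine variables the moment series is \<open>(1 - a\<^sup>2t\<^sup>2)\<close> to the power \<open>-1/2\<close>, hence its
  \<open>n\<close>-th power has exponent \<open>-n/2\<close> (lemma \<open>arcsin_moment_fps_power\<close>). The duplication formula for
  Pochhammer symbols identifies the resulting numbers with the moments of the power semicircle
  distribution with parameter \<open>(n-1)/2\<close>. Those follow from a recurrence by partial
  integration (lemma \<open>power_semicircle_law\<close>), which covers the arcsine distribution as the
  case \<open>\<lambda> = 0\<close>.
\<close>

section \<open>Bounded distributions are determined by their moments\<close>

text \<open>
  The Taylor remainder of the characteristic function of order \<open>m\<close> is at most
  \<open>2 (\<bar>t\<bar> a)\<^sup>m / m!\<close> when the distribution lives on \<open>[-a,a]\<close>, and this tends to \<open>0\<close>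
  for every \<open>t\<close>. Hence the characteristic function is the sum of its moment series on the
  whole line, which is what makes the moment problem determinate here.
\<close>

lemma char_bounded_tendsto:
  fixes D :: "real measure"
  assumes "real_distribution D" and bd: "AE x in D. \<bar>x\<bar> \<le> a"
  shows "(\<lambda>m. \<Sum>k\<le>m. ((\<i> * t) ^ k / fact k) * (\<integral>x. x ^ k \<partial>D)) \<longlonglongrightarrow> char D t"
proof -
  interpret real_distribution D by fact
  have pw: "AE x in D. \<bar>x\<bar> ^ k \<le> a ^ k" for k
    using bd by eventually_elim (simp add: power_mono)
  have int: "integrable D (\<lambda>x. x ^ k)" for k
    by (rule integrable_const_bound[where B = "a ^ k"]) (use pw[of k] in \<open>auto simp: power_abs\<close>)
  have mom: "(\<integral>x. \<bar>x\<bar> ^ k \<partial>D) \<le> a ^ k" for k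
    using integral_mono_AE[OF _ _ pw[of k]] integrable_abs[OF int[of k]]
    by (simp add: power_abs prob_space del: space_eq_univ)
  have le: "norm ((\<Sum>k\<le>m. ((\<i> * t) ^ k / fact k) * (\<integral>x. x ^ k \<partial>D)) - char D t)
      \<le> 2 * ((\<bar>t\<bar> * a) ^ m / fact m)" for m
  proof -
    have "norm ((\<Sum>k\<le>m. ((\<i> * t) ^ k / fact k) * (\<integral>x. x ^ k \<partial>D)) - char D t)
        \<le> 2 * \<bar>t\<bar> ^ m / fact m * (\<integral>x. \<bar>x\<bar> ^ m \<partial>D)"
      using char_approx1[of m t, OF int] by (subst norm_minus_commute) simp
    also have "\<dots> \<le> 2 * \<bar>t\<bar> ^ m / fact m * a ^ m"
      by (intro mult_left_mono mom) auto
    finally show ?thesis by (simp add: power_mult_distrib)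
  qed
  have "(\<lambda>m. (\<bar>t\<bar> * a) ^ m / fact m) \<longlonglongrightarrow> 0"
    using summable_LIMSEQ_zero[OF summable_exp[of "\<bar>t\<bar> * a"]] by (simp only: divide_inverse_commute)
  then have "(\<lambda>m. 2 * ((\<bar>t\<bar> * a) ^ m / fact m)) \<longlonglongrightarrow> 0"
    by (rule tendsto_mult_right_zero)
  then have "(\<lambda>m. (\<Sum>k\<le>m. ((\<i> * t) ^ k / fact k) * (\<integral>x. x ^ k \<partial>D)) - char D t) \<longlonglongrightarrow> 0"
    by (rule Lim_null_comparison[rotated]) (intro always_eventually allI le)
  then show ?thesis by (simp add: LIM_zero_iff)
qed

lemma bounded_moments_determine_distribution:
  fixes D D' :: "real measure"
  assumes "real_distribution D" "real_distribution D'"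
    and "AE x in D. \<bar>x\<bar> \<le> a" "AE x in D'. \<bar>x\<bar> \<le> a"
    and eq: "\<And>k. (\<integral>x. x ^ k \<partial>D) = (\<integral>x. x ^ k \<partial>D')"
  shows "D = D'"
proof (rule Levy_uniqueness)
  show "char D = char D'"
  proof
    fix t
    show "char D t = char D' t"
      using char_bounded_tendsto[OF assms(1,3), of t] char_bounded_tendsto[OF assms(2,4), of t]
      by (auto simp: eq intro: LIMSEQ_unique)
  qed
qed fact+

section \<open>Power semicircle distributions and their moments\<close>

text \<open>
  The complex duplication formula restricted to the positive axis. It turns the symmetric Beta
  integral below into the Gamma quotient that normalises the power semicircle density.
\<close>

lemma Gamma_duplication_real:
  fixes b :: real
  assumes "b > 0"
  shows "Gamma b * Gamma (b + 1/2) = 2 powr (1 - 2 * b) * sqrt pi * Gamma (2 * b)"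
proof -
  have b: "complex_of_real b \<notin> \<int>\<^sub>\<le>\<^sub>0" "complex_of_real b + 1/2 \<notin> \<int>\<^sub>\<le>\<^sub>0"
    using assms by (auto elim!: nonpos_Ints_cases simp: complex_eq_iff)
  have e: "complex_of_real b + 1/2 = complex_of_real (b + 1/2)" "2 * complex_of_real b = complex_of_real (2 * b)"
     "exp ((1 - complex_of_real (2 * b)) * complex_of_real (ln 2)) = complex_of_real (2 powr (1 - 2 * b))"
    by (simp_all add: powr_def exp_of_real[symmetric])
  show ?thesis
    using Gamma_legendre_duplication[OF b] 
    unfolding e Gamma_complex_of_real of_real_mult[symmetric] of_real_eq_iff by simp
qed

text \<open>
  The affine substitution \<open>x = 2at - a\<close> gives \<open>a\<^sup>2 - x\<^sup>2 = (2a)\<^sup>2 t (1 - t)\<close>, so the weight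
  becomes the integrand of the symmetric Beta integral. The exponent is written as \<open>b - 1\<close>
  with \<open>b = \<lambda> + 1/2\<close> to match.
\<close>

lemma has_integral_semicircle_weight:
  fixes a b :: real
  assumes a: "a > 0" and b: "b > 0"
  shows "((\<lambda>x. (a\<^sup>2 - x\<^sup>2) powr (b - 1)) has_integral
           sqrt pi * a powr (2 * b - 1) * (Gamma b / Gamma (b + 1/2))) {-a..a}"
proof -
  define c where "c = 2 * a"
  have c: "c > 0" using a by (simp add: c_def)
  have "((\<lambda>t. t powr (b - 1) * (1 - t) powr (b - 1)) has_integral Beta b b) (cbox 0 1)"
    using has_integral_Beta_real[OF b b] by simp
  from has_integral_affinity[OF this, of "1 / c" "1 / 2"] 
  have "((\<lambda>x. (x / c + 1/2) powr (b - 1) * (1/2 - x / c) powr (b - 1)) has_integral c * Beta b b)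
     ((\<lambda>x. c * x + - (c / 2)) ` {0..1})" using c by (simp add: algebra_simps)
  also have "(\<lambda>x. c * x + - (c / 2)) ` {0..1} = {-a..a}"
    using c a by (subst image_affinity_atLeastAtMost) (simp add: c_def)
  finally have "((\<lambda>x. c powr (2 * b - 2) * ((x / c + 1/2) powr (b - 1) * (1/2 - x / c) powr (b - 1)))
      has_integral c powr (2 * b - 2) * (c * Beta b b)) {-a..a}"
    by (rule has_integral_mult_right)
  also have "c powr (2 * b - 2) * (c * Beta b b) = c powr (2 * b - 1) * Beta b b"
    using c powr_add[of c "2 * b - 2" 1] by simp
  also have "\<dots> = sqrt pi * a powr (2 * b - 1) * (Gamma b / Gamma (b + 1/2))"
  proof -
    have pos: "Gamma b > 0" "Gamma (b + 1/2) > 0" "Gamma (2 * b) > 0" using b by (auto intro!: Gamma_real_pos)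
    have "Beta b b = 2 powr (1 - 2 * b) * sqrt pi * (Gamma b / Gamma (b + 1/2))"
      using Gamma_duplication_real[OF b] pos by (simp add: Beta_def field_simps)
    moreover have "2 powr (2 * b - 1) * 2 powr (1 - 2 * b) = (1::real)"
      by (simp flip: powr_add)
    ultimately show ?thesis
      using a by (simp add: c_def powr_mult mult_ac)
  qed
  finally show ?thesis
  proof (rule has_integral_eq[rotated])
    fix x assume x: "x \<in> {-a..a}"
    have nn: "x / c + 1/2 \<ge> 0" "1/2 - x / c \<ge> 0"
      using x c by (auto simp: c_def field_simps)
    have "c powr (2 * b - 2) = (c\<^sup>2) powr (b - 1)"
      using c by (simp add: powr_powr algebra_simps flip: powr_numeral)
    then have "c powr (2 * b - 2) * ((x / c + 1/2) powr (b - 1) * (1/2 - x / c) powr (b - 1)) =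
       (c\<^sup>2 * ((x / c + 1/2) * (1/2 - x / c))) powr (b - 1)"
      using c nn by (simp add: powr_mult mult_ac)
    also have "c\<^sup>2 * ((x / c + 1/2) * (1/2 - x / c)) = a\<^sup>2 - x\<^sup>2"
      using c by (simp add: c_def field_simps power2_eq_square)
    finally show "c powr (2 * b - 2) * ((x / c + 1/2) powr (b - 1) * (1/2 - x / c) powr (b - 1)) =
       (a\<^sup>2 - x\<^sup>2) powr (b - 1)" .
  qed
qed

text \<open>
  The even moments are \<open>a\<^sup>2\<^sup>k (1/2)\<^sub>k / (\<lambda>+1)\<^sub>k\<close>; for \<open>\<lambda> = 0\<close> they are the coefficients
  of \<open>(1 - a\<^sup>2t\<^sup>2)\<close> to the power \<open>-1/2\<close>.
\<close>

definition semicircle_moment :: "real \<Rightarrow> real \<Rightarrow> nat \<Rightarrow> real" where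
  "semicircle_moment l a m =
     (if even m then a ^ m * (pochhammer (1/2) (m div 2) / pochhammer (l + 1) (m div 2)) else 0)"

text \<open>
  Integrating the derivative of \<open>x\<^sup>j (a\<^sup>2 - x\<^sup>2)\<close> with the second factor raised to
  \<open>\<lambda> + 1/2\<close>, a function that vanishes at \<open>-a\<close> and \<open>a\<close>, yields the two-step recurrence
  \<open>(j + 2\<lambda> + 1) I\<^sub>j\<^sub>+\<^sub>1 = j a\<^sup>2 I\<^sub>j\<^sub>-\<^sub>1\<close> between the moments. Only the interior form of the
  fundamental theorem applies, since the weight may be unbounded at the end points.
\<close>

lemma has_integral_semicircle_weight_moment:
  fixes a l :: real
  assumes a: "a > 0" and l: "l > -1/2"
    and W: "((\<lambda>x. (a\<^sup>2 - x\<^sup>2) powr (l - 1/2)) has_integral W) {-a..a}"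
  shows "((\<lambda>x. x ^ m * (a\<^sup>2 - x\<^sup>2) powr (l - 1/2)) has_integral semicircle_moment l a m * W) {-a..a}"
proof -
  define w where "w = (\<lambda>x. (a\<^sup>2 - x\<^sup>2) powr (l - 1/2))"
  define F where "F = (\<lambda>j x. x ^ j * (a\<^sup>2 - x\<^sup>2) powr (l + 1/2))"
  define F' where "F' = (\<lambda>j x. (real j * a\<^sup>2 * x ^ (j - 1) - (real j + 2 * l + 1) * x ^ Suc j) * w x)"
  have F: "(F' j has_integral 0) {-a..a}" for j
  proof -
    have "(F' j has_integral F j a - F j (-a)) {-a..a}"
    proof (rule fundamental_theorem_of_calculus_interior)
      show "-a \<le> a" using a by simp
      show "continuous_on {-a..a} (F j)"
        unfolding F_def using l a
        by (intro continuous_intros continuous_on_powr')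
           (auto simp: abs_le_square_iff[symmetric] abs_le_iff)
    next
      fix x assume "x \<in> {-a<..<a}"
      then have "\<bar>x\<bar> < \<bar>a\<bar>" using a by auto
      then have x: "a\<^sup>2 - x\<^sup>2 > 0" using a power2_strict_mono[of x a] by simp
      have eq: "(a\<^sup>2 - x\<^sup>2) powr (l + 1/2) = (a\<^sup>2 - x\<^sup>2) * w x"
      proof -
        have "l + 1/2 = 1 + (l - 1/2)" by simp
        then show ?thesis unfolding w_def using x by (simp only: powr_add powr_one)
      qed
      have "(F j has_real_derivative real j * x ^ (j - 1) * (a\<^sup>2 - x\<^sup>2) powr (l + 1/2)
               + x ^ j * ((l + 1/2) * w x * (- 2 * x))) (at x)"
        unfolding F_def w_def using x
        by (auto intro!: derivative_eq_intros simp: algebra_simps)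
      also have "real j * x ^ (j - 1) * (a\<^sup>2 - x\<^sup>2) powr (l + 1/2) + x ^ j * ((l + 1/2) * w x * (- 2 * x)) = F' j x"
      proof (cases j)
        case 0
        then show ?thesis unfolding eq F'_def by (simp add: algebra_simps)
      next
        case (Suc i)
        then show ?thesis unfolding eq F'_def by (simp add: algebra_simps power2_eq_square)
      qed
      finally show "(F j has_vector_derivative F' j x) (at x)"
        by (simp add: has_real_derivative_iff_has_vector_derivative)
    qed
    then show ?thesis using l by (simp add: F_def)
  qed
  \<comment> \<open>For \<open>j = 0\<close> the factor \<open>j\<close> kills the truncated power, and the recurrence says that the first
    moment is zero; this starts the odd chain.\<close>
  have step: "((\<lambda>x. x ^ Suc j * w x) has_integral real j * a\<^sup>2 * I / (real j + 2 * l + 1)) {-a..a}"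
    if I: "((\<lambda>x. x ^ (j - 1) * w x) has_integral I) {-a..a}" for j I
  proof -
    have pos: "real j + 2 * l + 1 > 0" using l by simp
    have "((\<lambda>x. (real j * a\<^sup>2 * (x ^ (j - 1) * w x) - F' j x) / (real j + 2 * l + 1)) has_integral
            (real j * a\<^sup>2 * I - 0) / (real j + 2 * l + 1)) {-a..a}"
      by (intro has_integral_divide has_integral_diff has_integral_mult_right I F)
    then show ?thesis
      by (rule has_integral_eq_rhs[OF has_integral_eq[rotated]])
         (use pos in \<open>auto simp: F'_def field_simps\<close>)
  qed
  have "((\<lambda>x. x ^ m * w x) has_integral semicircle_moment l a m * W) {-a..a}"
  proof (induction m rule: induct_nat_012)
    case 0
    then show ?case using W by (simp add: semicircle_moment_def w_def)
  next
    case 1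
    then show ?case using step[of 0 W] W by (simp add: semicircle_moment_def w_def)
  next
    case (ge2 m)
    have pos: "pochhammer (l + 1) k > 0" for k
      using l by (intro pochhammer_pos) simp
    have "real (Suc m) * a\<^sup>2 * (semicircle_moment l a m * W) / (real (Suc m) + 2 * l + 1) =
      semicircle_moment l a (Suc (Suc m)) * W"
    proof (cases "even m")
      case True
      then obtain k where k: "m = 2 * k" by (elim evenE)
      have "real (Suc (2 * k)) + 2 * l + 1 > 0" "l + 1 + real k > 0" using l by auto
      then show ?thesis using pos[of k]
        by (simp add: semicircle_moment_def k pochhammer_Suc field_simps power2_eq_square)
    qed (simp add: semicircle_moment_def)
    moreover have "((\<lambda>x. x ^ (Suc m - 1) * w x) has_integral semicircle_moment l a m * W) {-a..a}"
      using ge2(1) by simp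
    from step[OF this] have "((\<lambda>x. x ^ Suc (Suc m) * w x) has_integral
        real (Suc m) * a\<^sup>2 * (semicircle_moment l a m * W) / (real (Suc m) + 2 * l + 1)) {-a..a}" .
    ultimately show ?case by (simp only:)
  qed
  then show ?thesis by (simp add: w_def)
qed

lemma power_semicircle_law:
  fixes l a :: real
  assumes a: "a > 0" and l: "l > -1/2"
  defines "D \<equiv> density lborel (\<lambda>x. ennreal (power_semicircle_density l a x))"
  shows "real_distribution D" "AE x in D. \<bar>x\<bar> \<le> a"
    and "(\<integral>x. x ^ m \<partial>D) = semicircle_moment l a m"
proof -
  define f where "f = power_semicircle_density l a"
  define C where "C = 1 / (sqrt pi * a powr (2 * l)) * (Gamma (l + 1) / Gamma (l + 1/2))"
  have Gpos: "Gamma (l + 1) > 0" "Gamma (l + 1/2) > 0" using l by (auto intro!: Gamma_real_pos)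
  have C: "C > 0" using Gpos a by (simp add: C_def)
  \<comment> \<open>The closed interval may be used because \<open>powr\<close> sends the base \<open>0\<close> to \<open>0\<close>.\<close>
  have f_eq: "f x = (if x \<in> {-a..a} then C * (a\<^sup>2 - x\<^sup>2) powr (l - 1/2) else 0)" for x
    using a by (auto simp: f_def power_semicircle_density_def C_def abs_less_iff power2_eq_iff
          intro: antisym)
  have [measurable]: "f \<in> borel_measurable borel"
    unfolding f_def power_semicircle_density_def[abs_def] by measurable
  have f0: "f x \<ge> 0" for x using C by (simp add: f_eq)
  have W: "((\<lambda>x. (a\<^sup>2 - x\<^sup>2) powr (l - 1/2)) has_integral 1 / C) {-a..a}"
    using has_integral_semicircle_weight[of a "l + 1/2"] a l Gpos
    by (simp add: C_def add.assoc algebra_simps)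
  have mom: "((\<lambda>x. f x * x ^ k) has_integral semicircle_moment l a k) UNIV" for k
  proof -
    have "((\<lambda>x. C * (x ^ k * (a\<^sup>2 - x\<^sup>2) powr (l - 1/2))) has_integral C * (semicircle_moment l a k * (1 / C))) {-a..a}"
      by (intro has_integral_mult_right has_integral_semicircle_weight_moment a l W)
    then have "((\<lambda>x. if x \<in> {-a..a} then C * (x ^ k * (a\<^sup>2 - x\<^sup>2) powr (l - 1/2)) else 0)
        has_integral semicircle_moment l a k) UNIV"
      using C by (subst has_integral_restrict_UNIV) simp
    then show ?thesis
      by (rule has_integral_eq[rotated]) (auto simp: f_eq)
  qed
  have D: "D = density lborel f" by (simp add: D_def f_def)
  have "emeasure D (space D) = 1"
    using nn_integral_has_integral_lborel[of f 1] mom[of 0] f0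
    by (simp add: D emeasure_density semicircle_moment_def)
  then interpret prob_space D by (rule prob_spaceI)
  show rd: "real_distribution D" by unfold_locales (simp_all add: D)
  show bd: "AE x in D. \<bar>x\<bar> \<le> a"
    unfolding D by (subst AE_density) (auto simp: f_eq)
  have int: "integrable D (\<lambda>x. x ^ m)"
    by (rule integrable_const_bound[where B = "a ^ m"])
       (use bd in \<open>auto simp: power_abs D elim!: eventually_mono intro: power_mono\<close>)
  have "(\<integral>x. x ^ m \<partial>D) = (\<integral>x. f x * x ^ m \<partial>lborel)"
    unfolding D by (subst integral_density) (auto simp: f0)
  also have "\<dots> = semicircle_moment l a m"
  proof (rule has_integral_unique[OF has_integral_integral_lborel mom])
    show "integrable lborel (\<lambda>x. f x * x ^ m)"
      using int unfolding D by (subst (asm) integrable_density) (auto simp: f0)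
  qed
  finally show "(\<integral>x. x ^ m \<partial>D) = semicircle_moment l a m" .
qed

lemma arcsin_density_eq_power_semicircle:
  "arcsin_density a = power_semicircle_density 0 a"
proof
  fix x
  show "arcsin_density a x = power_semicircle_density 0 a x"
  proof (cases "\<bar>x\<bar> < a")
    case True
    then have "x\<^sup>2 < a\<^sup>2" using power2_strict_mono[of x a] by simp
    then have "(a\<^sup>2 - x\<^sup>2) powr (- 1/2) = 1 / sqrt (a\<^sup>2 - x\<^sup>2)"
      by (simp add: powr_minus_divide powr_half_sqrt)
    then show ?thesis using True
      by (simp add: arcsin_density_def power_semicircle_density_def Gamma_one_half_real)
  qed (simp add: arcsin_density_def power_semicircle_density_def)
qed

text \<open>
  The formal counterpart of \<open>((1 - u) powr (-1/2))\<^sup>n = (1 - u) powr (-n/2)\<close> with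
  \<open>u = a\<^sup>2t\<^sup>2\<close>. The induction step compares coefficients, which is the Vandermonde
  identity for Pochhammer symbols.
\<close>

lemma arcsin_moment_fps_power:
  "Abs_fps (semicircle_moment 0 a) ^ n =
     Abs_fps (\<lambda>m. if even m then a ^ m * (pochhammer (real n / 2) (m div 2) / fact (m div 2)) else 0)"
proof (induction n)
  case 0
  have "pochhammer (0::real) k / fact k = (if k = 0 then 1 else 0)" for k
    by (simp add: pochhammer_0_left)
  then show ?case by (auto simp: fps_eq_iff elim!: evenE)
next
  case (Suc n)
  define c where "c = (\<lambda>m. if even m then a ^ m * (pochhammer (real n / 2) (m div 2) / fact (m div 2)) else 0)"
  show ?case unfolding power_Suc Suc.IH[folded c_def]
  proof (rule fps_ext)
    fix m
    have odd0: "semicircle_moment 0 a k * c (m - k) = 0" if "odd k \<or> odd (m - k)" for k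
      using that by (auto simp: semicircle_moment_def c_def)
    show "fps_nth (Abs_fps (semicircle_moment 0 a) * Abs_fps c) m =
      fps_nth (Abs_fps (\<lambda>m. if even m then a ^ m * (pochhammer (real (Suc n) / 2) (m div 2) / fact (m div 2)) else 0)) m"
    proof (cases "even m")
      case True
      then obtain k where k: "m = 2 * k" by (elim evenE)
      have "fps_nth (Abs_fps (semicircle_moment 0 a) * Abs_fps c) m = (\<Sum>i=0..m. semicircle_moment 0 a i * c (m - i))"
        by (simp add: fps_mult_nth)
      also have "\<dots> = (\<Sum>i\<in>(\<lambda>j. 2 * j) ` {..k}. semicircle_moment 0 a i * c (m - i))"
      proof (rule sum.mono_neutral_right)
        show "\<forall>i\<in>{0..m} - (\<lambda>j. 2 * j) ` {..k}. semicircle_moment 0 a i * c (m - i) = 0"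
        proof
          fix i assume i: "i \<in> {0..m} - (\<lambda>j. 2 * j) ` {..k}"
          have "odd i"
          proof
            assume "even i"
            then have "i = 2 * (i div 2)" by simp
            moreover have "i div 2 \<in> {..k}" using i unfolding k by auto
            ultimately have "i \<in> (\<lambda>j. 2 * j) ` {..k}" by (rule image_eqI)
            then show False using i by blast
          qed
          then show "semicircle_moment 0 a i * c (m - i) = 0" using odd0 by blast
        qed
      qed (auto simp: k)
      also have "\<dots> = (\<Sum>j\<le>k. semicircle_moment 0 a (2 * j) * c (m - 2 * j))"
        by (subst sum.reindex) (auto simp: inj_on_def)
      also have "\<dots> = (\<Sum>j\<le>k. a ^ m / fact k * 
           (of_nat (k choose j) * pochhammer (1/2) j * pochhammer (real n / 2) (k - j)))"
      proof (rule sum.cong)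
        fix j assume "j \<in> {..k}"
        then have j: "j \<le> k" by simp
        have m: "m - 2 * j = 2 * (k - j)" "m = 2 * j + 2 * (k - j)"
          using j by (simp_all add: k)
        have split: "a ^ m = a ^ (2 * j) * a ^ (2 * (k - j))"
          using m(2) by (metis power_add)
        have binom: "real (k choose j) / fact k = 1 / (fact j * fact (k - j))"
          using j by (simp add: binomial_fact)
        have "semicircle_moment 0 a (2 * j) * c (m - 2 * j) =
            a ^ m * (1 / (fact j * fact (k - j))) * (pochhammer (1/2) j * pochhammer (real n / 2) (k - j))"
          unfolding split m(1) by (simp add: semicircle_moment_def c_def pochhammer_fact[symmetric])
        then show "semicircle_moment 0 a (2 * j) * c (m - 2 * j) = a ^ m / fact k *
           (of_nat (k choose j) * pochhammer (1/2) j * pochhammer (real n / 2) (k - j))"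
          unfolding binom[symmetric] by simp
      qed simp
      also have "\<dots> = a ^ m / fact k * pochhammer (1/2 + real n / 2) k"
        by (simp add: pochhammer_binomial_sum sum_distrib_left)
      finally show ?thesis by (simp add: k add_divide_distrib add.commute)
    next
      case False
      then show ?thesis by (auto simp: fps_mult_nth intro!: sum.neutral odd0)
    qed
  qed
qed

section \<open>Moments of linear combinations of independent variables\<close>

text \<open>
  The factor \<open>1 / m!\<close> makes the binomial expansion a convolution of divided powers, and divided
  powers are exactly what the simplex integrals below combine without further constants.
\<close>

definition (in prob_space) linear_moment :: "(nat \<Rightarrow> 'a \<Rightarrow> real) \<Rightarrow> nat set \<Rightarrow> nat \<Rightarrow> (nat \<Rightarrow> real) \<Rightarrow> real" where
  "linear_moment X J m x = expectation (\<lambda>\<omega>. (\<Sum>j\<in>J. x j * X j \<omega>) ^ m) / fact m"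

lemma (in prob_space) integrable_bounded_power:
  assumes [measurable]: "Y \<in> borel_measurable M" and "AE \<omega> in M. \<bar>Y \<omega>\<bar> \<le> (B::real)"
  shows "integrable M (\<lambda>\<omega>. Y \<omega> ^ k)"
  by (rule integrable_const_bound[where B = "B ^ k"])
     (use assms(2) in eventually_elim, auto simp: power_abs intro: power_mono)

text \<open>
  Splitting off one summand by the binomial theorem and factorising the expectations by
  independence. Later inductions on \<open>J\<close> all run on this recursion.
\<close>

lemma (in prob_space) linear_moment_insert:
  assumes indep: "indep_vars (\<lambda>_. borel) X (insert i J)" and J: "finite J" "i \<notin> J"
    and bd: "\<And>j. j \<in> insert i J \<Longrightarrow> AE \<omega> in M. \<bar>X j \<omega>\<bar> \<le> a"
  shows "linear_moment X (insert i J) m x =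
    (\<Sum>k\<le>m. x i ^ k / fact k * expectation (\<lambda>\<omega>. X i \<omega> ^ k) * linear_moment X J (m - k) x)"
proof -
  define T where "T = (\<lambda>\<omega>. \<Sum>j\<in>J. x j * X j \<omega>)"
  have rv[measurable]: "X j \<in> borel_measurable M" if "j \<in> insert i J" for j
    using indep that by (auto simp: indep_vars_def)
  have T[measurable]: "T \<in> borel_measurable M"
    unfolding T_def using rv by measurable
  \<comment> \<open>The coefficient of \<open>X i\<close> is set to \<open>1\<close>, so that \<open>X i\<close> itself is separated from the
    remaining weighted sum.\<close>
  have "indep_vars (\<lambda>_. borel) (\<lambda>j \<omega>. (if j = i then 1 else x j) * X j \<omega>) (insert i J)"
    by (rule indep_vars_compose2[OF indep]) measurable
  from indep_vars_sum[OF J this]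
  have "indep_var borel (\<lambda>\<omega>. (if i = i then 1 else x i) * X i \<omega>)
      borel (\<lambda>\<omega>. \<Sum>j\<in>J. (if j = i then 1 else x j) * X j \<omega>)" .
  also have "(\<lambda>\<omega>. (if i = i then 1 else x i) * X i \<omega>) = X i"
    by simp
  also have "(\<lambda>\<omega>. \<Sum>j\<in>J. (if j = i then 1 else x j) * X j \<omega>) = T"
    unfolding T_def using J(2) by (intro ext sum.cong) auto
  finally have ind: "indep_var borel (\<lambda>\<omega>. X i \<omega> ^ k) borel (\<lambda>\<omega>. T \<omega> ^ l)" for k l
    using indep_var_compose[of borel "X i" borel T "\<lambda>y. y ^ k" borel "\<lambda>y. y ^ l" borel]
    by (simp add: comp_def)
  have "AE \<omega> in M. \<forall>j\<in>J. \<bar>X j \<omega>\<bar> \<le> a"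
    using bd J by (intro AE_finite_allI) auto
  then have bdT: "AE \<omega> in M. \<bar>T \<omega>\<bar> \<le> (\<Sum>j\<in>J. \<bar>x j\<bar> * a)"
    unfolding T_def
    by eventually_elim (intro order_trans[OF sum_abs] sum_mono, auto simp: abs_mult intro: mult_left_mono)
  have intX: "integrable M (\<lambda>\<omega>. X i \<omega> ^ k)" for k
    using bd by (intro integrable_bounded_power[where B = a]) auto
  have intT: "integrable M (\<lambda>\<omega>. T \<omega> ^ k)" for k
    by (rule integrable_bounded_power[OF T bdT])
  note mult = indep_var_lebesgue_integral[OF ind intX intT] indep_var_integrable[OF ind intX intT]
  have "expectation (\<lambda>\<omega>. (\<Sum>j\<in>insert i J. x j * X j \<omega>) ^ m) =
      expectation (\<lambda>\<omega>. \<Sum>k\<le>m. of_nat (m choose k) * x i ^ k * (X i \<omega> ^ k * T \<omega> ^ (m - k)))"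
  proof (rule Bochner_Integration.integral_cong)
    fix \<omega>
    have "(\<Sum>j\<in>insert i J. x j * X j \<omega>) = x i * X i \<omega> + T \<omega>"
      using J by (simp add: T_def)
    then show "(\<Sum>j\<in>insert i J. x j * X j \<omega>) ^ m =
        (\<Sum>k\<le>m. of_nat (m choose k) * x i ^ k * (X i \<omega> ^ k * T \<omega> ^ (m - k)))"
      by (simp only: binomial_ring power_mult_distrib mult.assoc)
  qed simp
  also have "\<dots> = (\<Sum>k\<le>m. of_nat (m choose k) * x i ^ k *
      (expectation (\<lambda>\<omega>. X i \<omega> ^ k) * expectation (\<lambda>\<omega>. T \<omega> ^ (m - k))))"
    by (subst Bochner_Integration.integral_sum) (auto simp: mult)
  finally have "linear_moment X (insert i J) m x = (\<Sum>k\<le>m. of_nat (m choose k) * x i ^ k *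
      (expectation (\<lambda>\<omega>. X i \<omega> ^ k) * expectation (\<lambda>\<omega>. T \<omega> ^ (m - k))) / fact m)"
    by (simp only: linear_moment_def sum_divide_distrib)
  also have "\<dots> = (\<Sum>k\<le>m. x i ^ k / fact k * expectation (\<lambda>\<omega>. X i \<omega> ^ k) * linear_moment X J (m - k) x)"
  proof (rule sum.cong)
    fix k assume "k \<in> {..m}"
    then have binom: "real (m choose k) = fact m / (fact k * fact (m - k))"
      by (simp add: binomial_fact)
    show "of_nat (m choose k) * x i ^ k *
      (expectation (\<lambda>\<omega>. X i \<omega> ^ k) * expectation (\<lambda>\<omega>. T \<omega> ^ (m - k))) / fact m =
      x i ^ k / fact k * expectation (\<lambda>\<omega>. X i \<omega> ^ k) * linear_moment X J (m - k) x"
      unfolding linear_moment_def T_def binom by simp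
  qed simp
  finally show ?thesis .
qed

text \<open>
  Nonnegative moments and nonnegative coefficients make every linear moment nonnegative, so the
  integrals over the simplex can be computed as integrals of nonnegative functions, without
  integrability side conditions.
\<close>

lemma (in prob_space) linear_moment_nonneg:
  assumes "indep_vars (\<lambda>_. borel) X I" and "finite J" "J \<subseteq> I"
    and "\<And>j. j \<in> I \<Longrightarrow> AE \<omega> in M. \<bar>X j \<omega>\<bar> \<le> a"
    and "\<And>j k. j \<in> I \<Longrightarrow> 0 \<le> expectation (\<lambda>\<omega>. X j \<omega> ^ k)"
    and "\<And>j. j \<in> J \<Longrightarrow> 0 \<le> x j"
  shows "0 \<le> linear_moment X J m x"
  using assms(2,3,6)
proof (induction J arbitrary: m rule: finite_induct)
  case empty
  then show ?case by (simp add: linear_moment_def)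
next
  case (insert i J)
  have "indep_vars (\<lambda>_. borel) X (insert i J)"
    using assms(1) insert.prems(1) by (rule indep_vars_subset)
  then show ?case
    by (subst linear_moment_insert[where a = a])
       (use insert assms(4,5) in \<open>auto intro!: sum_nonneg mult_nonneg_nonneg\<close>)
qed

lemma (in prob_space) linear_moment_measurable:
  assumes rv: "\<And>j. j \<in> J \<Longrightarrow> X j \<in> borel_measurable M"
  shows "linear_moment X J m \<in> borel_measurable (Pi\<^sub>M J (\<lambda>_. lborel))"
proof -
  have [measurable]: "(\<lambda>p. \<Sum>j\<in>J. fst p j * X j (snd p)) \<in> borel_measurable (Pi\<^sub>M J (\<lambda>_. lborel) \<Otimes>\<^sub>M M)"
  proof (rule borel_measurable_sum)
    fix j assume j: "j \<in> J"
    note [measurable] = rv[OF j]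
    have [measurable]: "(\<lambda>p. p j) \<in> borel_measurable (Pi\<^sub>M J (\<lambda>_. lborel :: real measure))"
      using measurable_component_singleton[OF j, of "\<lambda>_. lborel :: real measure"] by simp
    show "(\<lambda>p. fst p j * X j (snd p)) \<in> borel_measurable (Pi\<^sub>M J (\<lambda>_. lborel) \<Otimes>\<^sub>M M)"
      by measurable
  qed
  have "(\<lambda>x. expectation (\<lambda>\<omega>. (\<Sum>j\<in>J. x j * X j \<omega>) ^ m)) \<in> borel_measurable (Pi\<^sub>M J (\<lambda>_. lborel))"
    by (rule borel_measurable_lebesgue_integral) (simp add: split_beta')
  then show ?thesis
    unfolding linear_moment_def[abs_def] by measurable
qed

section \<open>Integrals of linear moments over a corner simplex\<close>

lemma has_real_derivative_divided_power:
  "((\<lambda>y. y ^ Suc k / fact (Suc k)) has_real_derivative y ^ k / fact k) (at y within A)"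
proof -
  have "((\<lambda>y. y ^ Suc k / fact (Suc k)) has_real_derivative (real (Suc k) * y ^ k) / fact (Suc k)) (at y within A)"
    by (intro DERIV_cdivide) (use DERIV_power_Suc[OF DERIV_ident, of k y A] in simp)
  also have "(real (Suc k) * y ^ k) / fact (Suc k) = y ^ k / fact k"
    by (simp del: of_nat_Suc)
  finally show ?thesis .
qed

lemma has_real_derivative_divided_power_diff:
  "((\<lambda>y. (s - y) ^ Suc k / fact (Suc k)) has_real_derivative - ((s - y) ^ k / fact k)) (at y within A)"
proof -
  have "((\<lambda>y. s - y) has_real_derivative - 1) (at y within A)"
    by (auto intro!: derivative_eq_intros)
  from DERIV_chain2[where f = "\<lambda>y. y ^ Suc k / fact (Suc k)" and g = "\<lambda>y. s - y",
      OF has_real_derivative_divided_power this]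
  show ?thesis by simp
qed

text \<open>
  The convolution of two divided powers on \<open>[0,s]\<close> is again a divided power. The product
  \<open>(y\<^sup>k\<^sup>+\<^sup>1 / (k+1)!) ((s-y)\<^sup>l\<^sup>+\<^sup>1 / (l+1)!)\<close> vanishes at both ends, so integrating its
  derivative trades one power of \<open>s - y\<close> for one power of \<open>y\<close>.
\<close>

lemma has_integral_scaled_beta:
  fixes s :: real
  assumes "s \<ge> 0"
  shows "((\<lambda>y. y ^ k / fact k * ((s - y) ^ l / fact l)) has_integral
            s ^ Suc (k + l) / fact (Suc (k + l))) {0..s}"
proof (induction k arbitrary: l)
  case 0
  have "((\<lambda>y. (s - y) ^ l / fact l) has_integral
      (- ((s - s) ^ Suc l / fact (Suc l)) - - ((s - 0) ^ Suc l / fact (Suc l)))) {0..s}"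
    using assms
    using DERIV_minus[OF has_real_derivative_divided_power_diff]
    by (intro fundamental_theorem_of_calculus)
       (auto simp: has_real_derivative_iff_has_vector_derivative[symmetric] simp del: power_Suc fact_Suc)
  then show ?case by simp
next
  case (Suc k)
  define F where "F = (\<lambda>y. y ^ Suc k / fact (Suc k) * ((s - y) ^ Suc l / fact (Suc l)))"
  have "((\<lambda>y. y ^ k / fact k * ((s - y) ^ Suc l / fact (Suc l)) -
           y ^ Suc k / fact (Suc k) * ((s - y) ^ l / fact l)) has_integral (F s - F 0)) {0..s}"
  proof (rule fundamental_theorem_of_calculus[OF assms])
    fix y assume "y \<in> {0..s}"
    have eq: "u * - v + u' * v' = u' * v' - u * v" for u v u' v' :: real
      by simp
    have "(F has_real_derivative y ^ k / fact k * ((s - y) ^ Suc l / fact (Suc l)) -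
           y ^ Suc k / fact (Suc k) * ((s - y) ^ l / fact l)) (at y within {0..s})"
      unfolding F_def
      by (rule DERIV_cong[OF DERIV_mult'[OF has_real_derivative_divided_power
              has_real_derivative_divided_power_diff] eq])
    then show "(F has_vector_derivative y ^ k / fact k * ((s - y) ^ Suc l / fact (Suc l)) -
           y ^ Suc k / fact (Suc k) * ((s - y) ^ l / fact l)) (at y within {0..s})"
      by (simp only: has_real_derivative_iff_has_vector_derivative)
  qed
  from has_integral_diff[OF Suc.IH[of "Suc l"] this]
  show ?case by (simp add: F_def)
qed

lemma nn_integral_scaled_beta:
  fixes s :: real
  assumes "s \<ge> 0"
  shows "(\<integral>\<^sup>+ y. ennreal (y ^ k / fact k * ((s - y) ^ l / fact l)) * indicator {0..s} y \<partial>lborel) =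
            ennreal (s ^ Suc (k + l) / fact (Suc (k + l)))"
  by (rule nn_integral_has_integral_lebesgue'[OF _ has_integral_scaled_beta[OF assms]]) auto

lemma fps_nth_power_nonneg:
  fixes f :: "real fps"
  assumes "\<And>k. 0 \<le> fps_nth f k"
  shows "0 \<le> fps_nth (f ^ n) k"
  by (induction n arbitrary: k) (auto simp: fps_mult_nth intro!: sum_nonneg mult_nonneg_nonneg assms)

text \<open>
  Functions outside the product space are also members; the underlying space is imposed by the
  measure that is integrated against.
\<close>

definition corner_simplex :: "nat set \<Rightarrow> real \<Rightarrow> (nat \<Rightarrow> real) set" where
  "corner_simplex J s = {x. (\<forall>j\<in>J. 0 \<le> x j) \<and> (\<Sum>j\<in>J. x j) \<le> s}"

lemma measurable_component_lborel:
  assumes "j \<in> J"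
  shows "(\<lambda>x. x j) \<in> borel_measurable (Pi\<^sub>M J (\<lambda>_. lborel :: real measure))"
  using measurable_component_singleton[OF assms, of "\<lambda>_. lborel :: real measure"] by simp

lemma measurable_sum_lborel:
  assumes "K \<subseteq> J"
  shows "(\<lambda>x. \<Sum>j\<in>K. x j) \<in> borel_measurable (Pi\<^sub>M J (\<lambda>_. lborel :: real measure))"
  using assms by (intro borel_measurable_sum measurable_component_lborel) auto

lemma indicator_corner_simplex_measurable:
  assumes "finite J"
  shows "(\<lambda>x. indicator (corner_simplex J s) x :: ennreal) \<in> borel_measurable (Pi\<^sub>M J (\<lambda>_. lborel))"
proof -
  note [measurable] = measurable_sum_lborel[OF order.refl, of J]
  have [measurable]: "Measurable.pred (Pi\<^sub>M J (\<lambda>_. lborel :: real measure)) (\<lambda>x. \<forall>j\<in>J. 0 \<le> x j)"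
    using assms
  proof (rule pred_intros_finite)
    fix j assume "j \<in> J"
    note [measurable] = measurable_component_lborel[OF this]
    show "Measurable.pred (Pi\<^sub>M J (\<lambda>_. lborel :: real measure)) (\<lambda>x. 0 \<le> x j)"
      by measurable
  qed
  have "(\<lambda>x. indicator (corner_simplex J s) x :: ennreal) =
     (\<lambda>x. if (\<forall>j\<in>J. 0 \<le> x j) \<and> (\<Sum>j\<in>J. x j) \<le> s then 1 else 0)"
    by (auto simp: corner_simplex_def indicator_def)
  then show ?thesis by simp
qed

text \<open>
  The heart of the computation. Expanding the linear moment into monomials, each monomial
  integrates by Dirichlet's formula: the integral of
  \<open>(s - (\<Sum>j. x j))\<^sup>p / p! \<cdot> (\<Prod>j. x j ^ k j / (k j)!)\<close> equals \<open>s\<^sup>N / N!\<close> with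
  \<open>N = p + (\<Sum>j. k j) + card J\<close>, which depends on the exponents only through their sum. What remains is the sum of
  \<open>\<Prod>j. \<mu> (k j)\<close> over all exponents of total degree \<open>m\<close>, that is, the coefficient of
  \<open>t\<^sup>m\<close> in the power \<open>card J\<close> of the moment generating series.

  The multi-index sum is never written down: the induction adds one coordinate \<open>y\<close> at a time,
  replaces \<open>s\<close> by \<open>s - y\<close> in the remaining simplex, and closes with the convolution of divided
  powers. The factor with exponent \<open>p\<close> is carried along because the last barycentric coordinate
  of the standard simplex, \<open>1 - \<Sum>j. x j\<close>, enters the average with its own power.
\<close>

lemma (in prob_space) nn_integral_corner_simplex_linear_moment:
  fixes X :: "nat \<Rightarrow> 'a \<Rightarrow> real"
  assumes indep: "indep_vars (\<lambda>_. borel) X I" and "finite J" "J \<subseteq> I"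
    and bd: "\<And>j. j \<in> I \<Longrightarrow> AE \<omega> in M. \<bar>X j \<omega>\<bar> \<le> a"
    and mom: "\<And>j k. j \<in> I \<Longrightarrow> expectation (\<lambda>\<omega>. X j \<omega> ^ k) = \<mu> k"
    and \<mu>: "\<And>k. \<mu> k \<ge> 0" and "s \<ge> 0"
  shows "(\<integral>\<^sup>+ x. ennreal ((s - (\<Sum>j\<in>J. x j)) ^ p / fact p * linear_moment X J m x) *
             indicator (corner_simplex J s) x \<partial>Pi\<^sub>M J (\<lambda>_. lborel)) =
         ennreal (s ^ (p + m + card J) / fact (p + m + card J) * fps_nth (Abs_fps \<mu> ^ card J) m)"
  using assms(2,3,7)
proof (induction J arbitrary: s p m rule: finite_induct)
  case empty
  interpret product_sigma_finite "\<lambda>_. lborel :: real measure" by standard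
  show ?case
    using empty by (subst nn_integral_empty) 
      (auto simp: corner_simplex_def linear_moment_def prob_space indicator_def)
next
  case (insert i J)
  interpret product_sigma_finite "\<lambda>_. lborel :: real measure" by standard
  define c where "c = fps_nth (Abs_fps \<mu> ^ card J)"
  have c0: "c k \<ge> 0" for k
    unfolding c_def using \<mu> by (intro fps_nth_power_nonneg) simp
  have rv: "X j \<in> borel_measurable M" if "j \<in> I" for j
    using indep that by (auto simp: indep_vars_def)
  have indep': "indep_vars (\<lambda>_. borel) X (insert i J)"
    using indep insert.prems(1) by (rule indep_vars_subset)
  note rec = linear_moment_insert[OF indep' insert.hyps bd]
  have nn: "0 \<le> linear_moment X J k x" if "x \<in> corner_simplex J t" for k x t
    using that insert.prems insert.hyps
    by (intro linear_moment_nonneg[OF indep _ _ bd]) (auto simp: corner_simplex_def mom \<mu>)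
  note [measurable] = linear_moment_measurable indicator_corner_simplex_measurable
    measurable_sum_lborel[OF order.refl]
  have inner: "(\<integral>\<^sup>+ x. ennreal ((s - (\<Sum>j\<in>insert i J. (x(i := y)) j)) ^ p / fact p *
        linear_moment X (insert i J) m (x(i := y))) * indicator (corner_simplex (insert i J) s) (x(i := y))
        \<partial>Pi\<^sub>M J (\<lambda>_. lborel)) =
      (\<Sum>k\<le>m. ennreal (\<mu> k * c (m - k)) * (ennreal (y ^ k / fact k * ((s - y) ^ (p + (m - k) + card J) / fact (p + (m - k) + card J)))
         * indicator {0..s} y))" (is "?lhs = _") for y
  proof (cases "y \<in> {0..s}")
    case False
    have "indicator (corner_simplex (insert i J) s) (x(i := y)) = (0::ennreal)" for x
    proof -
      have "(\<Sum>j\<in>J. (x(i := y)) j) = (\<Sum>j\<in>J. x j)" using insert.hyps by (intro sum.cong) auto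
      moreover have "(\<forall>j\<in>J. 0 \<le> (x(i := y)) j) \<longrightarrow> (\<forall>j\<in>J. 0 \<le> x j)" using insert.hyps by auto
      moreover have "(\<forall>j\<in>J. 0 \<le> x j) \<longrightarrow> (\<Sum>j\<in>J. x j) \<ge> 0" by (auto intro: sum_nonneg)
      ultimately show ?thesis
        using False insert.hyps by (auto simp: corner_simplex_def indicator_def)
    qed
    with False show ?thesis by simp
  next
    case True
    have "?lhs = (\<integral>\<^sup>+ x. (\<Sum>k\<le>m. ennreal (\<mu> k * (y ^ k / fact k)) *
        (ennreal ((s - y - (\<Sum>j\<in>J. x j)) ^ p / fact p * linear_moment X J (m - k) x) *
         indicator (corner_simplex J (s - y)) x)) \<partial>Pi\<^sub>M J (\<lambda>_. lborel))"
    proof (rule nn_integral_cong)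
      fix x :: "nat \<Rightarrow> real"
      have upd: "(\<Sum>j\<in>J. (x(i := y)) j) = (\<Sum>j\<in>J. x j)" 
        "linear_moment X J k (x(i := y)) = linear_moment X J k x" for k
        using insert.hyps unfolding linear_moment_def
        by (auto intro!: sum.cong Bochner_Integration.integral_cong arg_cong2[where f = "(^)"])
      have mem: "x(i := y) \<in> corner_simplex (insert i J) s \<longleftrightarrow> x \<in> corner_simplex J (s - y)"
        using insert.hyps upd(1) True by (auto simp: corner_simplex_def)
      show "ennreal ((s - (\<Sum>j\<in>insert i J. (x(i := y)) j)) ^ p / fact p *
        linear_moment X (insert i J) m (x(i := y))) * indicator (corner_simplex (insert i J) s) (x(i := y)) =
        (\<Sum>k\<le>m. ennreal (\<mu> k * (y ^ k / fact k)) *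
        (ennreal ((s - y - (\<Sum>j\<in>J. x j)) ^ p / fact p * linear_moment X J (m - k) x) *
         indicator (corner_simplex J (s - y)) x))"
      proof (cases "x \<in> corner_simplex J (s - y)")
        case x: True
        have real_eq: "(s - (\<Sum>j\<in>insert i J. (x(i := y)) j)) ^ p / fact p * linear_moment X (insert i J) m (x(i := y)) =
          (\<Sum>k\<le>m. (\<mu> k * (y ^ k / fact k)) * ((s - y - (\<Sum>j\<in>J. x j)) ^ p / fact p * linear_moment X J (m - k) x))"
        proof -
          have total: "(\<Sum>j\<in>insert i J. (x(i := y)) j) = y + (\<Sum>j\<in>J. x j)"
            by (simp only: sum.insert[OF insert.hyps] fun_upd_same upd(1))
          have "i \<in> I" using insert.prems by simp
          have "linear_moment X (insert i J) m (x(i := y)) =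
              (\<Sum>k\<le>m. (x(i := y)) i ^ k / fact k * expectation (\<lambda>\<omega>. X i \<omega> ^ k) * linear_moment X J (m - k) (x(i := y)))"
            using insert.prems by (intro rec) auto
          also have "\<dots> = (\<Sum>k\<le>m. y ^ k / fact k * \<mu> k * linear_moment X J (m - k) x)"
            by (simp only: mom[OF \<open>i \<in> I\<close>] upd(2) fun_upd_same)
          finally show ?thesis
            unfolding total diff_diff_eq by (simp add: sum_distrib_left mult_ac)
        qed
        have eq: "ennreal ((s - (\<Sum>j\<in>insert i J. (x(i := y)) j)) ^ p / fact p * linear_moment X (insert i J) m (x(i := y))) =
            (\<Sum>k\<le>m. ennreal (\<mu> k * (y ^ k / fact k)) *
            ennreal ((s - y - (\<Sum>j\<in>J. x j)) ^ p / fact p * linear_moment X J (m - k) x))"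
        proof -
          have nn': "0 \<le> \<mu> k * (y ^ k / fact k)"
            "0 \<le> (s - y - (\<Sum>j\<in>J. x j)) ^ p / fact p * linear_moment X J (m - k) x" for k
            using True \<mu>[of k] nn[OF x, of "m - k"] x by (auto simp: corner_simplex_def)
          show ?thesis
            unfolding real_eq ennreal_mult[OF nn', symmetric]
            by (rule sum_ennreal[symmetric]) (rule mult_nonneg_nonneg[OF nn'])
        qed
        have one: "indicator (corner_simplex (insert i J) s) (x(i := y)) = (1::ennreal)"
            "indicator (corner_simplex J (s - y)) x = (1::ennreal)"
          using x mem by (auto intro!: indicator_simps(1))
        show ?thesis
          unfolding eq one mult_1_right ..
      next
        case x: False
        have zero: "indicator (corner_simplex (insert i J) s) (x(i := y)) = (0::ennreal)"
            "indicator (corner_simplex J (s - y)) x = (0::ennreal)"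
          using x mem by (auto intro!: indicator_simps(2))
        show ?thesis
          unfolding zero mult_zero_right by simp
      qed
    qed
    also have "\<dots> = (\<Sum>k\<le>m. ennreal (\<mu> k * (y ^ k / fact k)) *
        ennreal ((s - y) ^ (p + (m - k) + card J) / fact (p + (m - k) + card J) * c (m - k)))"
    proof -
      have [measurable]: "linear_moment X J k \<in> borel_measurable (Pi\<^sub>M J (\<lambda>_. lborel))" for k
        using insert.prems rv by (intro linear_moment_measurable) auto
      define g where "g = (\<lambda>k x. ennreal ((s - y - (\<Sum>j\<in>J. x j)) ^ p / fact p * linear_moment X J (m - k) x) *
         indicator (corner_simplex J (s - y)) x)"
      have g[measurable]: "g k \<in> borel_measurable (Pi\<^sub>M J (\<lambda>_. lborel))" for k
        unfolding g_def using insert.hyps by measurable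
      have IH: "(\<integral>\<^sup>+ x. g k x \<partial>Pi\<^sub>M J (\<lambda>_. lborel)) =
          ennreal ((s - y) ^ (p + (m - k) + card J) / fact (p + (m - k) + card J) * c (m - k))" for k
        unfolding g_def c_def using insert.prems True by (intro insert.IH) auto
      have "(\<integral>\<^sup>+ x. (\<Sum>k\<le>m. ennreal (\<mu> k * (y ^ k / fact k)) * g k x) \<partial>Pi\<^sub>M J (\<lambda>_. lborel)) =
          (\<Sum>k\<le>m. \<integral>\<^sup>+ x. ennreal (\<mu> k * (y ^ k / fact k)) * g k x \<partial>Pi\<^sub>M J (\<lambda>_. lborel))"
        by (rule nn_integral_sum) measurable
      also have "\<dots> = (\<Sum>k\<le>m. ennreal (\<mu> k * (y ^ k / fact k)) *
          ennreal ((s - y) ^ (p + (m - k) + card J) / fact (p + (m - k) + card J) * c (m - k)))"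
        by (intro sum.cong refl) (simp only: nn_integral_cmult[OF g] IH)
      finally show ?thesis unfolding g_def .
    qed
    also have "\<dots> = (\<Sum>k\<le>m. ennreal (\<mu> k * c (m - k)) * (ennreal (y ^ k / fact k * ((s - y) ^ (p + (m - k) + card J) / fact (p + (m - k) + card J)))
         * indicator {0..s} y))"
    proof (intro sum.cong refl)
      fix k
      define q where "q = (s - y) ^ (p + (m - k) + card J) / fact (p + (m - k) + card J)"
      define r where "r = y ^ k / fact k"
      have "q \<ge> 0" "r \<ge> 0" using True by (auto simp: q_def r_def)
      then show "ennreal (\<mu> k * (y ^ k / fact k)) *
          ennreal ((s - y) ^ (p + (m - k) + card J) / fact (p + (m - k) + card J) * c (m - k)) =
        ennreal (\<mu> k * c (m - k)) * (ennreal (y ^ k / fact k * ((s - y) ^ (p + (m - k) + card J) / fact (p + (m - k) + card J)))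
         * indicator {0..s} y)"
        unfolding q_def[symmetric] r_def[symmetric] using True \<mu>[of k] c0[of "m - k"]
        by (simp flip: ennreal_mult add: mult_ac)
    qed
    finally show ?thesis .
  qed
  have "(\<integral>\<^sup>+ x. ennreal ((s - (\<Sum>j\<in>insert i J. x j)) ^ p / fact p * linear_moment X (insert i J) m x) *
             indicator (corner_simplex (insert i J) s) x \<partial>Pi\<^sub>M (insert i J) (\<lambda>_. lborel)) =
     (\<integral>\<^sup>+ y. (\<Sum>k\<le>m. ennreal (\<mu> k * c (m - k)) * (ennreal (y ^ k / fact k * ((s - y) ^ (p + (m - k) + card J) / fact (p + (m - k) + card J)))
         * indicator {0..s} y)) \<partial>lborel)"
  proof (subst product_nn_integral_insert_rev[OF insert.hyps])
    have [measurable]: "linear_moment X (insert i J) m \<in> borel_measurable (Pi\<^sub>M (insert i J) (\<lambda>_. lborel))"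
      using insert.prems rv by (intro linear_moment_measurable) auto
    have [measurable]: "(\<lambda>x. indicator (corner_simplex (insert i J) s) x :: ennreal) \<in> borel_measurable (Pi\<^sub>M (insert i J) (\<lambda>_. lborel))"
      using insert.hyps by (intro indicator_corner_simplex_measurable) auto
    show "(\<lambda>x. ennreal ((s - (\<Sum>j\<in>insert i J. x j)) ^ p / fact p * linear_moment X (insert i J) m x) *
             indicator (corner_simplex (insert i J) s) x) \<in> borel_measurable (Pi\<^sub>M (insert i J) (\<lambda>_. lborel))"
      by measurable
  qed (simp only: inner)
  also have "\<dots> = (\<Sum>k\<le>m. ennreal (\<mu> k * c (m - k)) * ennreal (s ^ Suc (k + (p + (m - k) + card J)) / fact (Suc (k + (p + (m - k) + card J)))))"
  proof -
    define g where "g = (\<lambda>k y. ennreal (y ^ k / fact k * ((s - y) ^ (p + (m - k) + card J) / fact (p + (m - k) + card J))) *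
       indicator {0..s} y)"
    have g[measurable]: "g k \<in> borel_measurable lborel" for k
      unfolding g_def by measurable
    have beta: "(\<integral>\<^sup>+ y. g k y \<partial>lborel) =
        ennreal (s ^ Suc (k + (p + (m - k) + card J)) / fact (Suc (k + (p + (m - k) + card J))))" for k
      unfolding g_def using insert.prems by (intro nn_integral_scaled_beta)
    have "(\<integral>\<^sup>+ y. (\<Sum>k\<le>m. ennreal (\<mu> k * c (m - k)) * g k y) \<partial>lborel) =
        (\<Sum>k\<le>m. \<integral>\<^sup>+ y. ennreal (\<mu> k * c (m - k)) * g k y \<partial>lborel)"
      by (rule nn_integral_sum) measurable
    then show ?thesis
      unfolding nn_integral_cmult[OF g] beta unfolding g_def .
  qed
  also have "\<dots> = (\<Sum>k\<le>m. ennreal (\<mu> k * c (m - k) * (s ^ (p + m + card (insert i J)) / fact (p + m + card (insert i J)))))"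
  proof (intro sum.cong refl)
    fix k assume "k \<in> {..m}"
    then have e: "Suc (k + (p + (m - k) + card J)) = p + m + card (insert i J)" using insert.hyps by simp
    show "ennreal (\<mu> k * c (m - k)) * ennreal (s ^ Suc (k + (p + (m - k) + card J)) / fact (Suc (k + (p + (m - k) + card J)))) =
      ennreal (\<mu> k * c (m - k) * (s ^ (p + m + card (insert i J)) / fact (p + m + card (insert i J))))"
      unfolding e using \<mu> c0 insert.prems by (intro ennreal_mult[symmetric]) auto
  qed
  also have "\<dots> = ennreal (\<Sum>k\<le>m. \<mu> k * c (m - k) * (s ^ (p + m + card (insert i J)) / fact (p + m + card (insert i J))))"
    using \<mu> c0 insert.prems by (intro sum_ennreal) auto
  also have "(\<Sum>k\<le>m. \<mu> k * c (m - k) * (s ^ (p + m + card (insert i J)) / fact (p + m + card (insert i J)))) =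
      s ^ (p + m + card (insert i J)) / fact (p + m + card (insert i J)) * fps_nth (Abs_fps \<mu> ^ card (insert i J)) m"
  proof -
    have "fps_nth (Abs_fps \<mu> ^ card (insert i J)) m = (\<Sum>k\<le>m. \<mu> k * c (m - k))"
      using insert.hyps by (simp add: c_def fps_mult_nth atMost_atLeast0)
    then show ?thesis by (simp only: sum_distrib_right mult.commute)
  qed
  finally show ?case .
qed

section \<open>Averages with Dirichlet weights\<close>

lemma emeasure_corner_simplex:
  assumes "finite J" "s \<ge> 0"
  shows "emeasure (Pi\<^sub>M J (\<lambda>_. lborel)) (corner_simplex J s \<inter> space (Pi\<^sub>M J (\<lambda>_. lborel))) =
    ennreal (s ^ card J / fact (card J))"
  using emeasure_std_simplex_aux[OF assms] by (simp add: corner_simplex_def)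

lemma corner_simplex_sets:
  assumes "finite J"
  shows "corner_simplex J s \<inter> space (Pi\<^sub>M J (\<lambda>_. lborel)) \<in> sets (Pi\<^sub>M J (\<lambda>_. lborel))"
  using indicator_corner_simplex_measurable[OF assms]
  by (simp only: borel_measurable_indicator_iff)

text \<open>
  The chart always produces coordinates with sum \<open>1\<close>, so only the sign conditions matter; the one
  on the last coordinate says that the first \<open>n - 1\<close> coordinates have sum at most \<open>1\<close>.
\<close>

lemma simplex_chart_in_unit_simplex_iff:
  assumes "n \<ge> 1"
  shows "simplex_chart n x \<in> unit_simplex n \<longleftrightarrow> x \<in> corner_simplex {1..<n} 1"
proof -
  have split: "{1..n} = insert n {1..<n}" using assms by auto
  have "(\<Sum>i=1..n. simplex_chart n x i) = simplex_chart n x n + (\<Sum>i=1..<n. simplex_chart n x i)"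
    unfolding split by simp
  also have "(\<Sum>i=1..<n. simplex_chart n x i) = (\<Sum>i=1..<n. x i)"
    by (intro sum.cong) (auto simp: simplex_chart_def)
  finally have "(\<Sum>i=1..n. simplex_chart n x i) = 1"
    using assms by (simp add: simplex_chart_def)
  moreover have "simplex_chart n x \<in> {1..n} \<rightarrow>\<^sub>E UNIV"
    by (simp add: simplex_chart_def)
  moreover have "(\<forall>i\<in>{1..n}. 0 \<le> simplex_chart n x i) \<longleftrightarrow>
      0 \<le> 1 - (\<Sum>i=1..<n. x i) \<and> (\<forall>i\<in>{1..<n}. 0 \<le> x i)"
    using assms unfolding split by (auto simp: simplex_chart_def)
  ultimately show ?thesis
    by (auto simp: unit_simplex_def corner_simplex_def)
qed

lemma simplex_chart_measurable:
  "simplex_chart n \<in> Pi\<^sub>M {1..<n} (\<lambda>_. lborel) \<rightarrow>\<^sub>M Pi\<^sub>M {1..n} (\<lambda>_. borel)"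
proof -
  note [measurable] = measurable_sum_lborel[OF order.refl, of "{1..<n}"]
  show ?thesis
    unfolding simplex_chart_def[abs_def]
  proof (rule measurable_restrict)
    fix i assume i: "i \<in> {1..n}"
    show "(\<lambda>x. if i = n then 1 - (\<Sum>j=1..<n. x j) else x i)
      \<in> Pi\<^sub>M {1..<n} (\<lambda>_. lborel :: real measure) \<rightarrow>\<^sub>M (borel :: real measure)"
    proof (cases "i = n")
      case False
      with i have "i \<in> {1..<n}" by auto
      then have "(\<lambda>x. x i) \<in> borel_measurable (Pi\<^sub>M {1..<n} (\<lambda>_. lborel :: real measure))"
        by (rule measurable_component_lborel)
      then show ?thesis unfolding if_not_P[OF False] .
    qed simp
  qed
qed

lemma dirichlet_ones_alt:
  assumes "n \<ge> 1"
  shows "dirichlet_ones n =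
     distr (uniform_measure (Pi\<^sub>M {1..<n} (\<lambda>_. lborel)) (corner_simplex {1..<n} 1 \<inter> space (Pi\<^sub>M {1..<n} (\<lambda>_. lborel))))
       (Pi\<^sub>M {1..n} (\<lambda>_. borel)) (simplex_chart n)"
proof -
  have "{x \<in> {1..<n} \<rightarrow>\<^sub>E UNIV. simplex_chart n x \<in> unit_simplex n} =
      corner_simplex {1..<n} 1 \<inter> space (Pi\<^sub>M {1..<n} (\<lambda>_. lborel))"
    using simplex_chart_in_unit_simplex_iff[OF assms] by (auto simp: space_PiM)
  then show ?thesis by (simp only: dirichlet_ones_def)
qed

lemma simplex_chart_measurable_uniform:
  "simplex_chart n \<in> uniform_measure (Pi\<^sub>M {1..<n} (\<lambda>_. lborel)) A \<rightarrow>\<^sub>M Pi\<^sub>M {1..n} (\<lambda>_. borel)"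
  unfolding measurable_cong_sets[OF sets_uniform_measure refl] by (rule simplex_chart_measurable)

lemma AE_dirichlet_ones:
  assumes "n \<ge> 1"
  shows "AE r in dirichlet_ones n. (\<forall>i\<in>{1..n}. 0 \<le> r i) \<and> (\<Sum>i=1..n. r i) = 1"
proof -
  note [measurable] = simplex_chart_measurable corner_simplex_sets
  have [measurable]: "Measurable.pred (Pi\<^sub>M {1..n} (\<lambda>_. borel :: real measure))
      (\<lambda>r. (\<forall>i\<in>{1..n}. 0 \<le> r i) \<and> (\<Sum>i=1..n. r i) = 1)"
    by measurable
  have "AE x in uniform_measure (Pi\<^sub>M {1..<n} (\<lambda>_. lborel)) (corner_simplex {1..<n} 1 \<inter> space (Pi\<^sub>M {1..<n} (\<lambda>_. lborel))).
      (\<forall>i\<in>{1..n}. 0 \<le> simplex_chart n x i) \<and> (\<Sum>i=1..n. simplex_chart n x i) = 1"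
    by (rule AE_uniform_measureI[OF corner_simplex_sets])
       (use simplex_chart_in_unit_simplex_iff[OF assms] in \<open>auto simp: unit_simplex_def\<close>)
  then show ?thesis
    unfolding dirichlet_ones_alt[OF assms]
    by (subst AE_distr_iff[OF simplex_chart_measurable_uniform]) measurable
qed

text \<open>
  The factor \<open>(n-1)!\<close> is the reciprocal of the volume of the corner simplex.
\<close>

lemma nn_integral_dirichlet_ones:
  assumes n: "n \<ge> 1" and f[measurable]: "f \<in> borel_measurable (Pi\<^sub>M {1..n} (\<lambda>_. borel))"
  shows "(\<integral>\<^sup>+ r. f r \<partial>dirichlet_ones n) = ennreal (fact (n - 1)) *
     (\<integral>\<^sup>+ x. f (simplex_chart n x) * indicator (corner_simplex {1..<n} 1) x \<partial>Pi\<^sub>M {1..<n} (\<lambda>_. lborel))"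
proof -
  let ?L = "Pi\<^sub>M {1..<n} (\<lambda>_. lborel :: real measure)"
  let ?C = "corner_simplex {1..<n} 1 \<inter> space ?L"
  note [measurable] = simplex_chart_measurable
  have C[measurable]: "?C \<in> sets ?L" by (rule corner_simplex_sets) simp
  have vol: "emeasure ?L ?C = ennreal (1 / fact (n - 1))"
    by (subst emeasure_corner_simplex) auto
  have "(\<integral>\<^sup>+ r. f r \<partial>dirichlet_ones n) = (\<integral>\<^sup>+ x. f (simplex_chart n x) \<partial>uniform_measure ?L ?C)"
    unfolding dirichlet_ones_alt[OF n] 
    using f by (intro nn_integral_distr[OF simplex_chart_measurable_uniform]) (simp only: measurable_distr_eq1)
  also have "\<dots> = (\<integral>\<^sup>+ x. f (simplex_chart n x) * indicator ?C x \<partial>?L) / ennreal (1 / fact (n - 1))"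
    unfolding vol[symmetric]
    by (rule nn_integral_uniform_measure[OF measurable_compose[OF simplex_chart_measurable f] C])
  also have "(\<integral>\<^sup>+ x. f (simplex_chart n x) * indicator ?C x \<partial>?L) =
      (\<integral>\<^sup>+ x. f (simplex_chart n x) * indicator (corner_simplex {1..<n} 1) x \<partial>?L)"
    by (intro nn_integral_cong) (simp add: indicator_def)
  also have "\<dots> / ennreal (1 / fact (n - 1)) = ennreal (fact (n - 1)) * \<dots>"
    by (simp add: divide_ennreal_def inverse_ennreal mult.commute)
  finally show ?thesis .
qed

text \<open>
  Substituting the chart turns the \<open>n\<close>-th weight into \<open>1 - \<Sum>j. x j\<close>. Splitting off the
  \<open>n\<close>-th variable leaves, for each power \<open>k\<close> of this weight, an integral over the corner simplex
  in the first \<open>n - 1\<close> coordinates; the sum over \<open>k\<close> supplies the last factor of the \<open>n\<close>-fold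
  product of the moment series.
\<close>

lemma (in prob_space) dirichlet_linear_moment:
  fixes X :: "nat \<Rightarrow> 'a \<Rightarrow> real"
  assumes n: "n \<ge> 1" and indep: "indep_vars (\<lambda>_. borel) X {1..n}"
    and bd: "\<And>j. j \<in> {1..n} \<Longrightarrow> AE \<omega> in M. \<bar>X j \<omega>\<bar> \<le> a"
    and mom: "\<And>j k. j \<in> {1..n} \<Longrightarrow> expectation (\<lambda>\<omega>. X j \<omega> ^ k) = \<mu> k"
    and \<mu>: "\<And>k. \<mu> k \<ge> 0"
  shows "(\<integral> r. linear_moment X {1..n} m r \<partial>dirichlet_ones n) =
     fact (n - 1) / fact (m + n - 1) * fps_nth (Abs_fps \<mu> ^ n) m"
proof -
  let ?L = "Pi\<^sub>M {1..<n} (\<lambda>_. lborel :: real measure)"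
  define J where "J = {1..<n}"
  define c where "c = fps_nth (Abs_fps \<mu> ^ (n - 1))"
  have c0: "c k \<ge> 0" for k
    unfolding c_def using \<mu> by (intro fps_nth_power_nonneg) simp
  have G0: "0 \<le> fps_nth (Abs_fps \<mu> ^ n) m"
    using \<mu> by (intro fps_nth_power_nonneg) simp
  have J: "{1..n} = insert n J" "finite J" "n \<notin> J" "J \<subseteq> {1..n}" "card J = n - 1"
    using n by (auto simp: J_def)
  have rv: "X j \<in> borel_measurable M" if "j \<in> {1..n}" for j
    using indep that by (auto simp: indep_vars_def)
  have meas[measurable]: "linear_moment X {1..n} m \<in> borel_measurable (Pi\<^sub>M {1..n} (\<lambda>_. borel))"
  proof -
    have eq: "sets (Pi\<^sub>M {1..n} (\<lambda>_. lborel :: real measure)) = sets (Pi\<^sub>M {1..n} (\<lambda>_. borel))"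
      by (rule sets_PiM_cong) auto
    from linear_moment_measurable[of "{1..n}" X, OF rv] show ?thesis
      unfolding measurable_cong_sets[OF eq refl] .
  qed
  define g where "g = (\<lambda>k x. ennreal ((1 - (\<Sum>j\<in>J. x j)) ^ k / fact k * linear_moment X J (m - k) x) *
      indicator (corner_simplex J 1) x)"
  have g[measurable]: "g k \<in> borel_measurable (Pi\<^sub>M J (\<lambda>_. lborel))" for k
  proof -
    have "linear_moment X J (m - k) \<in> borel_measurable (Pi\<^sub>M J (\<lambda>_. lborel))"
      using J rv by (intro linear_moment_measurable) auto
    note [measurable] = this indicator_corner_simplex_measurable[OF J(2)] measurable_sum_lborel[OF order.refl, of J]
    show ?thesis unfolding g_def by measurable
  qed
  have int_g: "(\<integral>\<^sup>+ x. g k x \<partial>Pi\<^sub>M J (\<lambda>_. lborel)) = ennreal (1 / fact (m + n - 1) * c (m - k))"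
    if "k \<le> m" for k
  proof -
    have "(\<integral>\<^sup>+ x. g k x \<partial>Pi\<^sub>M J (\<lambda>_. lborel)) =
        ennreal (1 ^ (k + (m - k) + card J) / fact (k + (m - k) + card J) * fps_nth (Abs_fps \<mu> ^ card J) (m - k))"
      unfolding g_def
      by (rule nn_integral_corner_simplex_linear_moment[OF indep J(2,4) bd mom \<mu>]) simp_all
    also have "k + (m - k) + card J = m + n - 1" using that n J(5) by simp
    finally show ?thesis by (simp only: J(5) c_def power_one)
  qed
  have pointwise: "ennreal (linear_moment X {1..n} m (simplex_chart n x)) * indicator (corner_simplex J 1) x =
      (\<Sum>k\<le>m. ennreal (\<mu> k) * g k x)" for x
  proof (cases "x \<in> corner_simplex J 1")
    case False
    then have zero: "indicator (corner_simplex J 1) x = (0::ennreal)" by (rule indicator_simps(2))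
    show ?thesis unfolding g_def zero mult_zero_right by simp
  next
    case True
    then have one: "indicator (corner_simplex J 1) x = (1::ennreal)" by (rule indicator_simps(1))
    have chart: "simplex_chart n x n = 1 - (\<Sum>j\<in>J. x j)"
      using n by (simp add: simplex_chart_def J_def)
    have restr: "linear_moment X J k (simplex_chart n x) = linear_moment X J k x" for k
    proof -
      have "(\<Sum>j\<in>J. simplex_chart n x j * X j \<omega>) = (\<Sum>j\<in>J. x j * X j \<omega>)" for \<omega>
        by (intro sum.cong) (auto simp: simplex_chart_def J_def)
      then show ?thesis by (simp only: linear_moment_def)
    qed
    have "n \<in> {1..n}" using n by simp
    have indep': "indep_vars (\<lambda>_. borel) X (insert n J)" using indep J(1) by simp
    have bd': "AE \<omega> in M. \<bar>X j \<omega>\<bar> \<le> a" if "j \<in> insert n J" for j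
      using that by (intro bd) (simp only: J(1))
    have "linear_moment X (insert n J) m (simplex_chart n x) =
        (\<Sum>k\<le>m. simplex_chart n x n ^ k / fact k * expectation (\<lambda>\<omega>. X n \<omega> ^ k) *
          linear_moment X J (m - k) (simplex_chart n x))"
      by (rule linear_moment_insert[OF indep' J(2,3) bd'])
    then have "linear_moment X {1..n} m (simplex_chart n x) =
        (\<Sum>k\<le>m. (1 - (\<Sum>j\<in>J. x j)) ^ k / fact k * \<mu> k * linear_moment X J (m - k) x)"
      unfolding chart restr mom[OF \<open>n \<in> {1..n}\<close>] J(1)[symmetric] .
    also have "\<dots> = (\<Sum>k\<le>m. \<mu> k * ((1 - (\<Sum>j\<in>J. x j)) ^ k / fact k * linear_moment X J (m - k) x))"
      by (simp add: mult_ac)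
    finally have real_eq: "linear_moment X {1..n} m (simplex_chart n x) =
      (\<Sum>k\<le>m. \<mu> k * ((1 - (\<Sum>j\<in>J. x j)) ^ k / fact k * linear_moment X J (m - k) x))" .
    have nn: "0 \<le> (1 - (\<Sum>j\<in>J. x j)) ^ k / fact k * linear_moment X J (m - k) x" for k
    proof -
      have "0 \<le> linear_moment X J (m - k) x"
        using True J
        by (intro linear_moment_nonneg[OF indep _ _ bd]) (auto simp: corner_simplex_def mom \<mu>)
      then show ?thesis using True by (auto simp: corner_simplex_def)
    qed
    show ?thesis
      unfolding real_eq g_def one mult_1_right ennreal_mult[OF \<mu> nn, symmetric]
      by (rule sum_ennreal[symmetric]) (rule mult_nonneg_nonneg[OF \<mu> nn])
  qed
  have "(\<integral>\<^sup>+ r. ennreal (linear_moment X {1..n} m r) \<partial>dirichlet_ones n) =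
      ennreal (fact (n - 1)) * (\<integral>\<^sup>+ x. (\<Sum>k\<le>m. ennreal (\<mu> k) * g k x) \<partial>Pi\<^sub>M J (\<lambda>_. lborel))"
    unfolding pointwise[symmetric] unfolding J_def by (rule nn_integral_dirichlet_ones[OF n]) measurable
  also have "(\<integral>\<^sup>+ x. (\<Sum>k\<le>m. ennreal (\<mu> k) * g k x) \<partial>Pi\<^sub>M J (\<lambda>_. lborel)) =
      (\<Sum>k\<le>m. \<integral>\<^sup>+ x. ennreal (\<mu> k) * g k x \<partial>Pi\<^sub>M J (\<lambda>_. lborel))"
    by (rule nn_integral_sum) measurable
  also have "\<dots> = (\<Sum>k\<le>m. ennreal (\<mu> k * (1 / fact (m + n - 1) * c (m - k))))"
  proof (rule sum.cong)
    fix k assume "k \<in> {..m}"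
    then have "k \<le> m" by simp
    show "(\<integral>\<^sup>+ x. ennreal (\<mu> k) * g k x \<partial>Pi\<^sub>M J (\<lambda>_. lborel)) =
        ennreal (\<mu> k * (1 / fact (m + n - 1) * c (m - k)))"
      unfolding nn_integral_cmult[OF g] int_g[OF \<open>k \<le> m\<close>]
      using \<mu> c0 by (intro ennreal_mult[symmetric]) auto
  qed simp
  also have "\<dots> = ennreal (\<Sum>k\<le>m. \<mu> k * (1 / fact (m + n - 1) * c (m - k)))"
    using \<mu> c0 by (intro sum_ennreal) auto
  also have "(\<Sum>k\<le>m. \<mu> k * (1 / fact (m + n - 1) * c (m - k))) = 1 / fact (m + n - 1) * fps_nth (Abs_fps \<mu> ^ n) m"
  proof -
    have "Abs_fps \<mu> ^ n = Abs_fps \<mu> * Abs_fps \<mu> ^ (n - 1)"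
      using n by (metis Suc_diff_1 less_eq_Suc_le One_nat_def power_Suc)
    then have "fps_nth (Abs_fps \<mu> ^ n) m = (\<Sum>k\<le>m. \<mu> k * c (m - k))"
      by (simp add: c_def fps_mult_nth atMost_atLeast0)
    then show ?thesis by (simp add: sum_distrib_left mult_ac)
  qed
  also have "ennreal (fact (n - 1)) * ennreal (1 / fact (m + n - 1) * fps_nth (Abs_fps \<mu> ^ n) m) =
      ennreal (fact (n - 1) / fact (m + n - 1) * fps_nth (Abs_fps \<mu> ^ n) m)"
    by (subst ennreal_mult[symmetric]) (simp_all add: G0)
  finally have nn_eq: "(\<integral>\<^sup>+ r. ennreal (linear_moment X {1..n} m r) \<partial>dirichlet_ones n) =
      ennreal (fact (n - 1) / fact (m + n - 1) * fps_nth (Abs_fps \<mu> ^ n) m)" .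
  have sets: "sets (dirichlet_ones n) = sets (Pi\<^sub>M {1..n} (\<lambda>_. borel))"
    by (simp add: dirichlet_ones_def)
  have "AE r in dirichlet_ones n. 0 \<le> linear_moment X {1..n} m r"
    using AE_dirichlet_ones[OF n]
  proof eventually_elim
    case (elim r)
    then show ?case by (intro linear_moment_nonneg[OF indep _ _ bd]) (auto simp: mom \<mu>)
  qed
  then have "(\<integral> r. linear_moment X {1..n} m r \<partial>dirichlet_ones n) =
      enn2real (\<integral>\<^sup>+ r. ennreal (linear_moment X {1..n} m r) \<partial>dirichlet_ones n)"
    using meas by (intro integral_eq_nn_integral) (simp_all add: measurable_cong_sets[OF sets refl])
  also have "\<dots> = fact (n - 1) / fact (m + n - 1) * fps_nth (Abs_fps \<mu> ^ n) m"
    unfolding nn_eq by (rule enn2real_ennreal) (simp add: G0)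
  finally show ?thesis .
qed

text \<open>
  Independence of weights and variables allows the weights to be frozen first: by Fubini the moment
  of the average is the Dirichlet integral of a linear moment. The outcome holds for any
  bounded variables with common nonnegative moments \<open>\<mu> k\<close>: the moment of order \<open>m\<close>, multiplied by
  the binomial coefficient \<open>m + n - 1\<close> over \<open>m\<close>, is the coefficient of \<open>t\<^sup>m\<close> in the \<open>n\<close>-th power
  of \<open>\<Sum>k. \<mu> k t\<^sup>k\<close>.
\<close>

lemma (in prob_space) dirichlet_average:
  fixes X R :: "nat \<Rightarrow> 'a \<Rightarrow> real"
  assumes n: "n \<ge> 1" and indep: "indep_vars (\<lambda>_. borel) X {1..n}"
    and bd: "\<And>j. j \<in> {1..n} \<Longrightarrow> AE \<omega> in M. \<bar>X j \<omega>\<bar> \<le> a"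
    and mom: "\<And>j k. j \<in> {1..n} \<Longrightarrow> expectation (\<lambda>\<omega>. X j \<omega> ^ k) = \<mu> k"
    and \<mu>: "\<And>k. \<mu> k \<ge> 0"
    and R_dirichlet: "distr M (Pi\<^sub>M {1..n} (\<lambda>_. borel)) (\<lambda>\<omega>. \<lambda>i\<in>{1..n}. R i \<omega>) = dirichlet_ones n"
    and R_X_indep: "indep_var
          (Pi\<^sub>M {1..n} (\<lambda>_. borel)) (\<lambda>\<omega>. \<lambda>i\<in>{1..n}. R i \<omega>)
          (Pi\<^sub>M {1..n} (\<lambda>_. borel)) (\<lambda>\<omega>. \<lambda>i\<in>{1..n}. X i \<omega>)"
  defines "S \<equiv> (\<lambda>\<omega>. \<Sum>i=1..n. R i \<omega> * X i \<omega>)"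
  shows dirichlet_average_measurable: "S \<in> borel_measurable M"
    and dirichlet_average_bounded: "AE \<omega> in M. \<bar>S \<omega>\<bar> \<le> a"
    and dirichlet_average_moment: "expectation (\<lambda>\<omega>. S \<omega> ^ m) =
      fact m * fact (n - 1) / fact (m + n - 1) * fps_nth (Abs_fps \<mu> ^ n) m"
proof -
  define P where "P = Pi\<^sub>M {1..n} (\<lambda>_. borel :: real measure)"
  define U where "U = (\<lambda>\<omega>. \<lambda>i\<in>{1..n}. R i \<omega>)"
  define V where "V = (\<lambda>\<omega>. \<lambda>i\<in>{1..n}. X i \<omega>)"
  define g where "g = (\<lambda>(u, v). \<Sum>i=1..n. u i * v i :: real)"
  have UV: "U \<in> M \<rightarrow>\<^sub>M P" "V \<in> M \<rightarrow>\<^sub>M P" "distr M P U \<Otimes>\<^sub>M distr M P V = distr M (P \<Otimes>\<^sub>M P) (\<lambda>\<omega>. (U \<omega>, V \<omega>))"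
    using R_X_indep unfolding indep_var_distribution_eq P_def U_def V_def by auto
  note [measurable] = UV(1,2)
  have g[measurable]: "g \<in> borel_measurable (P \<Otimes>\<^sub>M P)"
    unfolding g_def P_def by measurable
  have S: "S = (\<lambda>\<omega>. g (U \<omega>, V \<omega>))"
    by (simp add: S_def g_def U_def V_def)
  show S_meas[measurable]: "S \<in> borel_measurable M"
    unfolding S by measurable
  have "AE r in distr M P U. (\<forall>i\<in>{1..n}. 0 \<le> r i) \<and> (\<Sum>i=1..n. r i) = 1"
    unfolding P_def U_def R_dirichlet by (rule AE_dirichlet_ones[OF n])
  from AE_distrD[OF UV(1) this]
  have R_AE: "AE \<omega> in M. (\<forall>i\<in>{1..n}. 0 \<le> R i \<omega>) \<and> (\<Sum>i=1..n. R i \<omega>) = 1"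
    by (simp add: U_def)
  have X_AE: "AE \<omega> in M. \<forall>i\<in>{1..n}. \<bar>X i \<omega>\<bar> \<le> a"
    using bd by (intro AE_finite_allI) auto
  show S_AE: "AE \<omega> in M. \<bar>S \<omega>\<bar> \<le> a"
    using R_AE X_AE
  proof eventually_elim
    case (elim \<omega>)
    have "\<bar>S \<omega>\<bar> \<le> (\<Sum>i=1..n. \<bar>R i \<omega> * X i \<omega>\<bar>)"
      unfolding S_def by (rule sum_abs)
    also have "\<dots> \<le> (\<Sum>i=1..n. R i \<omega> * a)"
      using elim by (intro sum_mono) (auto simp: abs_mult intro!: mult_left_mono)
    also have "\<dots> = a"
      using elim by (simp flip: sum_distrib_right)
    finally show ?case .
  qed
  have intS: "integrable M (\<lambda>\<omega>. S \<omega> ^ m)"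
    by (rule integrable_bounded_power[OF S_meas S_AE])
  have gm: "(\<lambda>p. g p ^ m) \<in> borel_measurable (P \<Otimes>\<^sub>M P)" by measurable
  interpret U: prob_space "distr M P U" by (rule prob_space_distr[OF UV(1)])
  interpret V: prob_space "distr M P V" by (rule prob_space_distr[OF UV(2)])
  interpret UV: pair_prob_space "distr M P U" "distr M P V" ..
  have pair: "(\<lambda>\<omega>. (U \<omega>, V \<omega>)) \<in> M \<rightarrow>\<^sub>M P \<Otimes>\<^sub>M P" by measurable
  have int_g: "integrable (distr M P U \<Otimes>\<^sub>M distr M P V) (\<lambda>p. g p ^ m)"
    unfolding UV(3) using intS unfolding S by (simp add: integrable_distr_eq[OF pair gm])
  have "expectation (\<lambda>\<omega>. S \<omega> ^ m) = (\<integral> p. g p ^ m \<partial>(distr M P U \<Otimes>\<^sub>M distr M P V))"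
    unfolding UV(3) S by (rule integral_distr[OF pair gm, symmetric])
  also have "\<dots> = (\<integral> u. (\<integral> v. g (u, v) ^ m \<partial>distr M P V) \<partial>distr M P U)"
    by (rule UV.integral_fst'[OF int_g, symmetric])
  also have "\<dots> = (\<integral> u. fact m * linear_moment X {1..n} m u \<partial>distr M P U)"
  proof (rule Bochner_Integration.integral_cong)
    fix u assume "u \<in> space (distr M P U)"
    then have "u \<in> space P" by simp
    then have "(\<lambda>v. g (u, v) ^ m) \<in> borel_measurable P"
      using measurable_compose[OF measurable_Pair1' gm] by simp
    then have "(\<integral> v. g (u, v) ^ m \<partial>distr M P V) = expectation (\<lambda>\<omega>. g (u, V \<omega>) ^ m)"
      by (rule integral_distr[OF UV(2)])
    also have "\<dots> = fact m * linear_moment X {1..n} m u"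
      by (simp add: linear_moment_def g_def V_def)
    finally show "(\<integral> v. g (u, v) ^ m \<partial>distr M P V) = fact m * linear_moment X {1..n} m u" .
  qed simp
  also have "\<dots> = fact m * (\<integral> u. linear_moment X {1..n} m u \<partial>dirichlet_ones n)"
    unfolding P_def U_def R_dirichlet by (rule integral_mult_right_zero)
  also have "(\<integral> u. linear_moment X {1..n} m u \<partial>dirichlet_ones n) =
      fact (n - 1) / fact (m + n - 1) * fps_nth (Abs_fps \<mu> ^ n) m"
    by (rule dirichlet_linear_moment[OF n indep bd mom \<mu>])
  finally show "expectation (\<lambda>\<omega>. S \<omega> ^ m) =
      fact m * fact (n - 1) / fact (m + n - 1) * fps_nth (Abs_fps \<mu> ^ n) m"
    by simp
qed

section \<open>The average of arcsine variables\<close>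

text \<open>
  With \<open>m = 2k\<close>, duplicating both \<open>(1)\<^sub>2\<^sub>k = (2k)!\<close> and
  \<open>(n)\<^sub>2\<^sub>k = (2k+n-1)! / (n-1)!\<close> into half-integer Pochhammer symbols cancels \<open>k!\<close> and
  \<open>(n/2)\<^sub>k\<close>. The surviving quotient \<open>(1/2)\<^sub>k / ((n+1)/2)\<^sub>k\<close> is the power semicircle
  moment with \<open>\<lambda> + 1 = (n+1)/2\<close>.
\<close>

lemma arcsin_fps_coeff_eq_semicircle_moment:
  assumes n: "n \<ge> 1"
  shows "fact m * fact (n - 1) / fact (m + n - 1) * fps_nth (Abs_fps (semicircle_moment 0 a) ^ n) m =
     semicircle_moment ((real n - 1) / 2) a m"
proof (cases "even m")
  case False
  then show ?thesis by (simp add: arcsin_moment_fps_power semicircle_moment_def)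
next
  case True
  then obtain k where k: "m = 2 * k" by (elim evenE)
  define p q h where "p = pochhammer (real n / 2) k"
    and "q = pochhammer (real n / 2 + 1/2) k" and "h = pochhammer (1/2 :: real) k"
  have pos: "p > 0" "q > 0" "h > 0"
    using n by (auto simp: p_def q_def h_def intro!: pochhammer_pos)
  have fact_m: "fact m = 4 ^ k * h * (fact k :: real)"
    using pochhammer_double[of "1/2 :: real" k] by (simp add: k h_def pochhammer_fact power_mult)
  have "(fact (n - 1 + m) :: real) = fact (n - 1) * pochhammer (1 + real (n - 1)) m"
    unfolding pochhammer_fact by (rule pochhammer_product')
  also have "1 + real (n - 1) = 2 * (real n / 2)" using n by (simp add: of_nat_diff)
  also have "pochhammer (2 * (real n / 2)) m = 4 ^ k * p * q"
    unfolding k pochhammer_double by (simp add: p_def q_def power_mult)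
  finally have fact_mn: "(fact (m + n - 1) :: real) = fact (n - 1) * (4 ^ k * p * q)"
    using n by (simp add: add.commute)
  have G: "fps_nth (Abs_fps (semicircle_moment 0 a) ^ n) m = a ^ m * (p / fact k)"
    unfolding arcsin_moment_fps_power by (simp add: k p_def)
  have l: "(real n - 1) / 2 + 1 = real n / 2 + 1/2" by (simp add: field_simps)
  have R: "semicircle_moment ((real n - 1) / 2) a m = a ^ m * (h / q)"
    unfolding semicircle_moment_def l by (simp add: k h_def q_def)
  show ?thesis
    unfolding G R fact_m fact_mn using pos by simp
qed

theorem theorem2p2:
  fixes M :: "'a measure" and X R :: "nat \<Rightarrow> 'a \<Rightarrow> real" and n :: nat and a :: real
  assumes "prob_space M"
    and "n \<ge> 2" and "a > 0"
    and X_indep: "prob_space.indep_vars M (\<lambda>_. borel) X {1..n}"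
    and X_arcsin: "\<And>i. i \<in> {1..n} \<Longrightarrow> distributed M lborel (X i) (\<lambda>x. ennreal (arcsin_density a x))"
    and R_dirichlet: "distr M (Pi\<^sub>M {1..n} (\<lambda>_. borel)) (\<lambda>\<omega>. \<lambda>i\<in>{1..n}. R i \<omega>) = dirichlet_ones n"
    and R_X_indep: "prob_space.indep_var M
          (Pi\<^sub>M {1..n} (\<lambda>_. borel)) (\<lambda>\<omega>. \<lambda>i\<in>{1..n}. R i \<omega>)
          (Pi\<^sub>M {1..n} (\<lambda>_. borel)) (\<lambda>\<omega>. \<lambda>i\<in>{1..n}. X i \<omega>)"
  shows "distributed M lborel (\<lambda>\<omega>. \<Sum>i=1..n. R i \<omega> * X i \<omega>)
           (\<lambda>x. ennreal (power_semicircle_density ((real n - 1) / 2) a x))"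
proof -
  interpret prob_space M by fact
  define l where "l = (real n - 1) / 2"
  define S where "S = (\<lambda>\<omega>. \<Sum>i=1..n. R i \<omega> * X i \<omega>)"
  have n: "n \<ge> 1" and l: "l > - 1/2" using \<open>n \<ge> 2\<close> by (auto simp: l_def)
  have X_meas: "X j \<in> M \<rightarrow>\<^sub>M lborel" if "j \<in> {1..n}" for j
    using distributed_measurable[OF X_arcsin[OF that]] .
  have X_distr: "distr M lborel (X j) = density lborel (\<lambda>x. ennreal (power_semicircle_density 0 a x))"
    if "j \<in> {1..n}" for j
    using distributed_distr_eq_density[OF X_arcsin[OF that]]
    by (simp only: arcsin_density_eq_power_semicircle)
  note arcsin = power_semicircle_law[of a 0, OF \<open>a > 0\<close>, simplified]
  have bd: "AE \<omega> in M. \<bar>X j \<omega>\<bar> \<le> a" if "j \<in> {1..n}" for j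
    using AE_distrD[OF X_meas[OF that], of "\<lambda>x. \<bar>x\<bar> \<le> a"] arcsin(2)
    unfolding X_distr[OF that] by blast
  have mom: "expectation (\<lambda>\<omega>. X j \<omega> ^ k) = semicircle_moment 0 a k" if "j \<in> {1..n}" for j k
    using integral_distr[OF X_meas[OF that], of "\<lambda>x. x ^ k"] arcsin(3)[of k]
    unfolding X_distr[OF that] by simp
  have nonneg: "semicircle_moment 0 a k \<ge> 0" for k
    using \<open>a > 0\<close> by (auto simp: semicircle_moment_def intro!: mult_nonneg_nonneg divide_nonneg_nonneg pochhammer_nonneg)
  have S_borel: "S \<in> borel_measurable M"
    unfolding S_def by (rule dirichlet_average_measurable[OF n X_indep bd mom nonneg R_dirichlet R_X_indep])
  have S_bounded: "AE \<omega> in M. \<bar>S \<omega>\<bar> \<le> a"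
    unfolding S_def by (rule dirichlet_average_bounded[OF n X_indep bd mom nonneg R_dirichlet R_X_indep])
  have S_moment: "expectation (\<lambda>\<omega>. S \<omega> ^ k) =
      fact k * fact (n - 1) / fact (k + n - 1) * fps_nth (Abs_fps (semicircle_moment 0 a) ^ n) k" for k
    unfolding S_def by (rule dirichlet_average_moment[OF n X_indep bd mom nonneg R_dirichlet R_X_indep])
  define D where "D = density lborel (\<lambda>x. ennreal (power_semicircle_density l a x))"
  note semicircle = power_semicircle_law[OF \<open>a > 0\<close> l, folded D_def]
  have S_meas: "S \<in> M \<rightarrow>\<^sub>M lborel" using S_borel by simp
  interpret S: prob_space "distr M lborel S" by (rule prob_space_distr[OF S_meas])
  have "distr M lborel S = D"
  proof (rule bounded_moments_determine_distribution)
    show "real_distribution (distr M lborel S)" by unfold_locales simp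
    show "real_distribution D" by (rule semicircle(1))
    show "AE x in distr M lborel S. \<bar>x\<bar> \<le> a"
      using S_bounded by (subst AE_distr_iff[OF S_meas]) auto
    show "AE x in D. \<bar>x\<bar> \<le> a" by (rule semicircle(2))
    fix k
    have "(\<integral>x. x ^ k \<partial>distr M lborel S) = expectation (\<lambda>\<omega>. S \<omega> ^ k)"
      by (rule integral_distr[OF S_meas]) simp
    also have "\<dots> = semicircle_moment l a k"
      unfolding S_moment l_def by (rule arcsin_fps_coeff_eq_semicircle_moment[OF n])
    also have "\<dots> = (\<integral>x. x ^ k \<partial>D)" by (rule semicircle(3)[symmetric])
    finally show "(\<integral>x. x ^ k \<partial>distr M lborel S) = (\<integral>x. x ^ k \<partial>D)" .
  qed
  moreover have "(\<lambda>x. ennreal (power_semicircle_density l a x)) \<in> borel_measurable lborel"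
    unfolding power_semicircle_density_def[abs_def] by measurable
  ultimately show ?thesis
    using S_meas unfolding distributed_def S_def D_def l_def by simp
qed

end
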